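(* Let $n\in\mathbb N$ and let $f,f_1,f_2\in\mathcal A_r^n$ with respective primitives $F,F_1,F_2\in\mathcal B_r$. Let $a_1,a_2\in\mathbb R$ and $\phi\in\mathcal D(\mathbb R)$. (a) With operations given by $$\langle a_1f_1+a_2f_2,\phi\rangle=a_1\langle f_1,\phi\rangle+a_2\langle f_2,\phi\rangle=(-1)^n\bigl(a_1\langle F_1,\phi^{(n)}\rangle+a_2\langle F_2,\phi^{(n)}\rangle\bigr)=(-1)^n\Bigl(a_1\int_{-\infty}^\infty F_1(x)\phi^{(n)}(x)\,dx+a_2\int_{-\infty}^\infty F_2(x)\phi^{(n)}(x)\,dx\Bigr),$$ $\mathcal A_r^n$ is a vector space, and $\mathcal A_c^n$ is a subspace of $\mathcal A_r^n$. (b) $\|f\|_{a,n}=\|F\|_\infty$ defines a norm on $\mathcal A_r^n$. This makes $\mathcal A_r^n$ into a Banach space that is not separable. $\mathcal A_r^n$ is isometrically isomorphic to $\mathcal B_r$, and $\mathcal A_c^n$ is a separable Banach space isometrically isomorphic to $\mathcal B_c$. (c) Each distribution in $\mathcal A_r^n$ is tempered and of order at most $n$. (d) Let $\mathcal O:\mathcal D'(\mathbb R)\to\mathcal D'(\mathbb R)$ be an operator that commutes with the derivative, i.e. $(\mathcal O T)'=\mathcal O(T')$ for all $T\in\mathcal D'(\mathbb R)$. Then $\langle\mathcal O f,\phi\rangle=(-1)^n\langle\mathcal O F,\phi^{(n)}\rangle$. (e) Let $t\in\mathbb R$ and $T\in\mathcal D'(\mathbb R)$. Then $T\in\mathcal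 A_r^n$ if and only if $\tau_tT\in\mathcal A_r^n$, and likewise $T\in\mathcal A_c^n$ if and only if $\tau_tT\in\mathcal A_c^n$. If $f\in\mathcal A_r^n$ then $\|\tau_tf\|_{a,n}=\|f\|_{a,n}$. (f) For each $f\in\mathcal A_c^n$, $\lim_{t\to0}\|f-\tau_tf\|_{a,n}=0$. (g) $C^\infty(\mathbb R)\cap\mathcal A_c^n$ is dense in $\mathcal A_c^n$, but $C^\infty(\mathbb R)\cap\mathcal A_r^n$ is not dense in $\mathcal A_r^n$.
   Context: Write $\overline{\mathbb R}=[-\infty,\infty]$. A function $F:\overline{\mathbb R}\to\mathbb R$ is regulated if the one-sided limits $F(x-),F(x+)$ exist in $\mathbb R$ for every $x\in\mathbb R$ and the limits $\lim_{x\to\pm\infty}F(x)$ exist in $\mathbb R$; by convention $F(\pm\infty)$ equals these limits. $\mathcal B_r$ is the space of regulated $F$ with $F(-\infty)=0$ and $F(x)=F(x-)$ for all $x\in\mathbb R$. $\mathcal B_c$ is the space of functions continuous on $\overline{\mathbb R}$ (continuous on $\mathbb R$, with $F(\pm\infty)=\lim_{x\to\pm\infty}F(x)\in\mathbb R$) with $F(-\infty)=0$. Both carry pointwise operations and the norm $\|F\|_\infty=\sup_{x\in\mathbb R}|F(x)|$, under which they are Banach spaces. $\mathcal D(\mathbb R)=C_c^\infty(\mathbb R)$ and $\mathcal D'(\mathbb R)$ is the space of distributions. $F^{(n)}=D^nF$ is the distributional derivative, $\langle F^{(n)},\phi\rangle=(-1)^n\langle F,\phi^{(n)}\rangle$,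 where locally integrable functions are identified with the distributions they define. For $n\in\mathbb N=\{1,2,\dots\}$, $\mathcal A_r^n=\{f\in\mathcal D'(\mathbb R): f=F^{(n)}\text{ for some }F\in\mathcal B_r\}$ and $\mathcal A_c^n=\{f\in\mathcal D'(\mathbb R): f=F^{(n)}\text{ for some }F\in\mathcal B_c\}$; the function $F$ is unique and is called the primitive of $f$. On $\mathcal A_c^n$ the norm is also $\|f\|_{a,n}=\|F\|_\infty$. Translation: $\tau_t\phi(x)=\phi(x-t)$ and $\langle\tau_tT,\phi\rangle=\langle T,\tau_{-t}\phi\rangle$. A distribution $T$ has order at most $n$ if for each compact $K\subset\mathbb R$ there is $C\ge0$ with $|\langle T,\phi\rangle|\le C\sum_{k=0}^n\|\phi^{(k)}\|_\infty$ for all $\phi\in\mathcal D(\mathbb R)$ with support in $K$. *)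

theory Defs
  imports "HOL-Analysis.Analysis" "HOL-Library.Function_Algebras"
begin

section \<open>Pointwise real vector space structure on functions\<close>

instantiation "fun" :: (type, scaleR) scaleR
begin
definition "c *\<^sub>R f = (\<lambda>x. c *\<^sub>R f x)"
instance ..
end

lemma scaleR_fun_apply [simp]: "(c *\<^sub>R f) x = c *\<^sub>R f x"
  by (simp add: scaleR_fun_def)

instance "fun" :: (type, real_vector) real_vector
  by standard (simp_all add: fun_eq_iff scaleR_add_right scaleR_add_left)


section \<open>Norms on subspaces\<close>

text \<open>A normed space is given by a subspace \<open>S\<close> of some real vector space and a function \<open>N\<close>
  of which only the values on \<open>S\<close> matter.  The distance is set to zero outside \<open>S\<close> because the locale
  \<open>Metric_space\<close> demands nonnegativity and symmetry on the whole type.\<close>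

definition norm_on :: "'a::real_vector set \<Rightarrow> ('a \<Rightarrow> real) \<Rightarrow> bool" where
  "norm_on S N \<longleftrightarrow>
     (\<forall>x\<in>S. 0 \<le> N x \<and> (N x = 0 \<longleftrightarrow> x = 0)) \<and>
     (\<forall>c. \<forall>x\<in>S. N (c *\<^sub>R x) = \<bar>c\<bar> * N x) \<and>
     (\<forall>x\<in>S. \<forall>y\<in>S. N (x + y) \<le> N x + N y)"

definition norm_dist :: "'a::real_vector set \<Rightarrow> ('a \<Rightarrow> real) \<Rightarrow> 'a \<Rightarrow> 'a \<Rightarrow> real" where
  "norm_dist S N x y = (if x \<in> S \<and> y \<in> S then N (x - y) else 0)"

lemma Metric_space_norm_dist:
  assumes S: "subspace S" and N: "norm_on S N"
  shows "Metric_space S (norm_dist S N)"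
proof -
  have diff: "x - y \<in> S" if "x \<in> S" "y \<in> S" for x y
    using S that by (rule subspace_diff)
  have commute: "N (x - y) = N (y - x)" if "x \<in> S" "y \<in> S" for x y
  proof -
    have "N ((- 1) *\<^sub>R (y - x)) = \<bar>- 1\<bar> * N (y - x)"
      using N diff[OF that(2,1)] unfolding norm_on_def by blast
    then show ?thesis by simp
  qed
  have triangle: "N (x - z) \<le> N (x - y) + N (y - z)" if "x \<in> S" "y \<in> S" "z \<in> S" for x y z
  proof -
    have "N ((x - y) + (y - z)) \<le> N (x - y) + N (y - z)"
      using N diff[OF that(1,2)] diff[OF that(2,3)] unfolding norm_on_def by blast
    then show ?thesis by simp
  qed
  show ?thesis
  proof
    show "0 \<le> norm_dist S N x y" for x y
      using N diff by (auto simp: norm_dist_def norm_on_def)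
    show "norm_dist S N x y = norm_dist S N y x" for x y
      using commute by (auto simp: norm_dist_def)
    show "norm_dist S N x y = 0 \<longleftrightarrow> x = y" if "x \<in> S" "y \<in> S" for x y
      using N diff[OF that] that by (auto simp: norm_dist_def norm_on_def)
    show "norm_dist S N x z \<le> norm_dist S N x y + norm_dist S N y z"
      if "x \<in> S" "y \<in> S" "z \<in> S" for x y z
      using triangle[OF that] that by (simp add: norm_dist_def)
  qed
qed

definition norm_topology :: "'a::real_vector set \<Rightarrow> ('a \<Rightarrow> real) \<Rightarrow> 'a topology" where
  "norm_topology S N = Metric_space.mtopology S (norm_dist S N)"

definition banach_on :: "'a::real_vector set \<Rightarrow> ('a \<Rightarrow> real) \<Rightarrow> bool" where
  "banach_on S N \<longleftrightarrow>
     subspace S \<and> norm_on S N \<and> Metric_space.mcomplete S (norm_dist S N)"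

definition isometrically_isomorphic ::
    "'a::real_vector set \<Rightarrow> ('a \<Rightarrow> real) \<Rightarrow> 'b::real_vector set \<Rightarrow> ('b \<Rightarrow> real) \<Rightarrow> bool" where
  "isometrically_isomorphic S N S' N' \<longleftrightarrow>
     (\<exists>\<Phi>. bij_betw \<Phi> S S' \<and>
          (\<forall>a b. \<forall>x\<in>S. \<forall>y\<in>S. \<Phi> (a *\<^sub>R x + b *\<^sub>R y) = a *\<^sub>R \<Phi> x + b *\<^sub>R \<Phi> y) \<and>
          (\<forall>x\<in>S. N' (\<Phi> x) = N x))"

text \<open>Meaningful for bounded \<open>g\<close> only.\<close>

definition sup_norm :: "(real \<Rightarrow> real) \<Rightarrow> real" where
  "sup_norm g = (SUP x. \<bar>g x\<bar>)"


section \<open>Test functions\<close>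

definition smooth :: "(real \<Rightarrow> real) \<Rightarrow> bool" where
  "smooth g \<longleftrightarrow> (\<forall>k x. (deriv ^^ k) g differentiable (at x))"

definition supp :: "(real \<Rightarrow> real) \<Rightarrow> real set" where
  "supp g = closure {x. g x \<noteq> 0}"

lemma smooth_DERIV:
  assumes "smooth g"
  shows "((deriv ^^ k) g has_real_derivative (deriv ^^ Suc k) g x) (at x)"
  using assms by (simp add: smooth_def DERIV_deriv_iff_real_differentiable)

lemma smoothI:
  assumes "\<And>k x. ((deriv ^^ k) g has_real_derivative h k x) (at x)"
  shows "smooth g"
  unfolding smooth_def using assms real_differentiable_def by blast

lemma higher_deriv_lincomb:
  assumes "smooth f" "smooth g"
  shows "(deriv ^^ k) (\<lambda>x. a * f x + b * g x) = (\<lambda>x. a * (deriv ^^ k) f x + b * (deriv ^^ k) g x)"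
proof (induction k)
  case (Suc k)
  have "deriv (\<lambda>x. a * (deriv ^^ k) f x + b * (deriv ^^ k) g x) x
      = a * (deriv ^^ Suc k) f x + b * (deriv ^^ Suc k) g x" for x
    by (intro DERIV_imp_deriv DERIV_add DERIV_cmult smooth_DERIV assms)
  then have "deriv (\<lambda>x. a * (deriv ^^ k) f x + b * (deriv ^^ k) g x)
      = (\<lambda>x. a * (deriv ^^ Suc k) f x + b * (deriv ^^ Suc k) g x)" ..
  with Suc show ?case by simp
qed simp

lemma smooth_lincomb:
  assumes "smooth f" "smooth g"
  shows "smooth (\<lambda>x. a * f x + b * g x)"
proof (rule smoothI)
  show "((deriv ^^ k) (\<lambda>x. a * f x + b * g x) has_real_derivative
      a * (deriv ^^ Suc k) f x + b * (deriv ^^ Suc k) g x) (at x)" for k x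
    unfolding higher_deriv_lincomb[OF assms] by (intro DERIV_add DERIV_cmult smooth_DERIV assms)
qed

lemma higher_deriv_shift:
  assumes "smooth f"
  shows "(deriv ^^ k) (\<lambda>x. f (x - t)) = (\<lambda>x. (deriv ^^ k) f (x - t))"
proof (induction k)
  case (Suc k)
  have "((\<lambda>x. (deriv ^^ k) f (x - t)) has_real_derivative (deriv ^^ Suc k) f (x - t)) (at x)" for x
    using smooth_DERIV[OF assms, of k "x - t"] DERIV_shift[of "(deriv ^^ k) f" _ x "- t"] by simp
  then have "deriv (\<lambda>x. (deriv ^^ k) f (x - t)) = (\<lambda>x. (deriv ^^ Suc k) f (x - t))"
    by (intro ext DERIV_imp_deriv)
  with Suc show ?case by simp
qed simp

lemma smooth_shift:
  assumes "smooth f"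
  shows "smooth (\<lambda>x. f (x - t))"
proof (rule smoothI)
  fix k x
  show "((deriv ^^ k) (\<lambda>x. f (x - t)) has_real_derivative (deriv ^^ Suc k) f (x - t)) (at x)"
    using smooth_DERIV[OF assms, of k "x - t"] DERIV_shift[of "(deriv ^^ k) f" _ x "- t"]
    by (simp add: higher_deriv_shift[OF assms])
qed

lemma smooth_deriv:
  assumes "smooth f"
  shows "smooth (deriv f)"
proof (rule smoothI)
  fix k x
  show "((deriv ^^ k) (deriv f) has_real_derivative (deriv ^^ Suc (Suc k)) f x) (at x)"
    using smooth_DERIV[OF assms, of "Suc k" x] by (simp add: funpow_swap1)
qed

lemma compact_supp_lincomb:
  assumes "compact (supp f)" "compact (supp g)"
  shows "compact (supp (\<lambda>x. a * f x + b * g x))"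
proof -
  have "supp (\<lambda>x. a * f x + b * g x) \<subseteq> supp f \<union> supp g"
    unfolding supp_def closure_Un[symmetric] by (rule closure_mono) auto
  then show ?thesis
    using assms by (metis closed_closure closed_subset compact_Int_closed compact_Un inf.absorb_iff2 supp_def)
qed

lemma supp_shift: "supp (\<lambda>x. f (x - t)) = (\<lambda>x. x + t) ` supp f"
proof -
  have "{x. f (x - t) \<noteq> 0} = (\<lambda>x. t + x) ` {x. f x \<noteq> 0}"
    by (force simp: image_iff intro: exI[of _ "_ - t"])
  then show ?thesis
    unfolding supp_def by (simp only: closure_translation add.commute[of _ t])
qed

lemma supp_deriv_subset:
  shows "supp (deriv f) \<subseteq> supp f"
proof -
  have "deriv f x = 0" if "x \<notin> supp f" for x
  proof -
    have "open (- supp f)" "x \<in> - supp f"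
      using that by (auto simp: supp_def)
    moreover have "f y = 0" if "y \<in> - supp f" for y
      using that closure_subset by (force simp: supp_def)
    ultimately have "(f has_real_derivative 0) (at x)"
      by (intro DERIV_const[THEN has_field_derivative_transform_within_open]) auto
    then show ?thesis by (rule DERIV_imp_deriv)
  qed
  then have "{x. deriv f x \<noteq> 0} \<subseteq> supp f" by auto
  then show ?thesis
    unfolding supp_def[of "deriv f"] by (simp add: closure_minimal supp_def)
qed

lemma smooth_zero: "smooth (\<lambda>x. 0)"
proof -
  have "(deriv ^^ k) (\<lambda>x::real. 0::real) = (\<lambda>x. 0)" for k
    by (induction k) simp_all
  then show ?thesis
    by (simp add: smooth_def)
qed

typedef test_fun = "{\<phi>. smooth \<phi> \<and> compact (supp \<phi>)}"
  morphisms apply_test Abs_test_fun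
  by (rule exI[of _ "\<lambda>x. 0"]) (simp add: supp_def smooth_zero)

setup_lifting type_definition_test_fun

instantiation test_fun :: real_vector
begin

lift_definition zero_test_fun :: test_fun is "\<lambda>x. 0"
  by (simp add: supp_def smooth_zero)

lift_definition plus_test_fun :: "test_fun \<Rightarrow> test_fun \<Rightarrow> test_fun" is "\<lambda>\<phi> \<psi> x. \<phi> x + \<psi> x"
  using smooth_lincomb[where a = 1 and b = 1] compact_supp_lincomb[where a = 1 and b = 1] by auto

lift_definition minus_test_fun :: "test_fun \<Rightarrow> test_fun \<Rightarrow> test_fun" is "\<lambda>\<phi> \<psi> x. \<phi> x - \<psi> x"
  using smooth_lincomb[where a = 1 and b = "-1"] compact_supp_lincomb[where a = 1 and b = "-1"] by auto

lift_definition uminus_test_fun :: "test_fun \<Rightarrow> test_fun" is "\<lambda>\<phi> x. - \<phi> x"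
  subgoal for \<phi>
    using smooth_lincomb[of \<phi> \<phi> "-1" 0] compact_supp_lincomb[of \<phi> \<phi> "-1" 0] by simp
  done

lift_definition scaleR_test_fun :: "real \<Rightarrow> test_fun \<Rightarrow> test_fun" is "\<lambda>c \<phi> x. c * \<phi> x"
  subgoal for c \<phi>
    using smooth_lincomb[of \<phi> \<phi> c 0] compact_supp_lincomb[of \<phi> \<phi> c 0] by simp
  done

instance
  by (standard; transfer) (simp_all add: fun_eq_iff algebra_simps)

end

lift_definition test_deriv :: "test_fun \<Rightarrow> test_fun" is deriv
  by (metis (mono_tags, lifting) closed_closure compact_Int_closed inf.absorb_iff2 mem_Collect_eq
      smooth_deriv supp_def supp_deriv_subset)

lift_definition test_translate :: "real \<Rightarrow> test_fun \<Rightarrow> test_fun" is "\<lambda>t \<phi> x. \<phi> (x - t)"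
  by (auto simp: smooth_shift supp_shift intro!: compact_continuous_image continuous_intros)

lemma apply_test_deriv_funpow: "apply_test ((test_deriv ^^ n) \<phi>) = (deriv ^^ n) (apply_test \<phi>)"
  by (induction n) (simp_all add: test_deriv.rep_eq)

definition test_conv :: "(nat \<Rightarrow> test_fun) \<Rightarrow> test_fun \<Rightarrow> bool" where
  "test_conv \<phi>s \<phi> \<longleftrightarrow>
     (\<exists>K. compact K \<and> (\<forall>j. supp (apply_test (\<phi>s j)) \<subseteq> K) \<and> supp (apply_test \<phi>) \<subseteq> K) \<and>
     (\<forall>k. uniform_limit UNIV (\<lambda>j. (deriv ^^ k) (apply_test (\<phi>s j)))
                              ((deriv ^^ k) (apply_test \<phi>)) sequentially)"

lemma linear_test_deriv_funpow: "linear (test_deriv ^^ n)"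
proof -
  have "apply_test ((test_deriv ^^ n) (a *\<^sub>R \<phi> + b *\<^sub>R \<psi>))
      = apply_test (a *\<^sub>R (test_deriv ^^ n) \<phi> + b *\<^sub>R (test_deriv ^^ n) \<psi>)" for a b \<phi> \<psi>
    using apply_test[of \<phi>] apply_test[of \<psi>]
    by (simp add: apply_test_deriv_funpow plus_test_fun.rep_eq scaleR_test_fun.rep_eq
        higher_deriv_lincomb)
  then have *: "(test_deriv ^^ n) (a *\<^sub>R \<phi> + b *\<^sub>R \<psi>)
      = a *\<^sub>R (test_deriv ^^ n) \<phi> + b *\<^sub>R (test_deriv ^^ n) \<psi>" for a b \<phi> \<psi>
    by (simp add: apply_test_inject)
  show ?thesis
    by (rule linearI) (use *[of 1 _ 1] *[of _ _ 0] in simp_all)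
qed

lemma test_conv_deriv_funpow:
  assumes "test_conv \<phi>s \<phi>"
  shows "test_conv (\<lambda>j. (test_deriv ^^ n) (\<phi>s j)) ((test_deriv ^^ n) \<phi>)"
proof -
  have "supp ((deriv ^^ n) f) \<subseteq> supp f" for f
    by (induction n) (use supp_deriv_subset in force)+
  then show ?thesis
    using assms unfolding test_conv_def apply_test_deriv_funpow
      funpow_add[symmetric, THEN fun_cong, unfolded o_apply]
    by (meson order_trans)
qed

lemma linear_test_translate: "linear (test_translate t)"
  by (rule linearI; transfer) simp_all

lemma test_conv_translate:
  assumes "test_conv \<phi>s \<phi>"
  shows "test_conv (\<lambda>j. test_translate t (\<phi>s j)) (test_translate t \<phi>)"
proof -
  obtain K where K: "compact K" "\<And>j. supp (apply_test (\<phi>s j)) \<subseteq> K" "supp (apply_test \<phi>) \<subseteq> K"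
    using assms by (auto simp: test_conv_def)
  have sm: "smooth (apply_test \<psi>)" for \<psi>
    using apply_test[of \<psi>] by simp
  have "compact ((\<lambda>x. x + t) ` K)"
    by (intro compact_continuous_image continuous_intros K)
  moreover have "uniform_limit UNIV (\<lambda>j x. (deriv ^^ k) (apply_test (\<phi>s j)) (x - t))
      (\<lambda>x. (deriv ^^ k) (apply_test \<phi>) (x - t)) sequentially" for k
  proof (rule uniform_limit_compose')
    show "uniform_limit UNIV (\<lambda>j. (deriv ^^ k) (apply_test (\<phi>s j)))
        ((deriv ^^ k) (apply_test \<phi>)) sequentially"
      using assms by (simp add: test_conv_def)
  qed simp
  ultimately show ?thesis
    unfolding test_conv_def test_translate.rep_eq supp_shift higher_deriv_shift[OF sm]
    using K by (intro conjI allI exI[of _ "(\<lambda>x. x + t) ` K"] image_mono) auto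
qed


section \<open>Distributions\<close>

text \<open>For linear functionals on the test functions, sequential continuity is equivalent to
  continuity in the usual inductive limit topology.\<close>

typedef distribution =
    "{T :: test_fun \<Rightarrow> real. linear T \<and>
        (\<forall>\<phi>s \<phi>. test_conv \<phi>s \<phi> \<longrightarrow> (\<lambda>j. T (\<phi>s j)) \<longlonglongrightarrow> T \<phi>)}"
  morphisms pairing Abs_distribution
  by (rule exI[of _ "\<lambda>_. 0"]) (simp add: linear_iff)

notation pairing (\<open>\<langle>_,/ _\<rangle>\<close>)

setup_lifting type_definition_distribution

instantiation distribution :: real_vector
begin

lift_definition zero_distribution :: distribution is "\<lambda>\<phi>. 0"
  by (simp add: linear_iff)

lift_definition plus_distribution :: "distribution \<Rightarrow> distribution \<Rightarrow> distribution"
  is "\<lambda>S T \<phi>. S \<phi> + T \<phi>"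
  by (auto intro: linear_compose_add tendsto_add)

lift_definition minus_distribution :: "distribution \<Rightarrow> distribution \<Rightarrow> distribution"
  is "\<lambda>S T \<phi>. S \<phi> - T \<phi>"
  by (auto intro: linear_compose_sub tendsto_diff)

lift_definition uminus_distribution :: "distribution \<Rightarrow> distribution" is "\<lambda>T \<phi>. - T \<phi>"
  by (auto intro: linear_compose_neg tendsto_minus)

lift_definition scaleR_distribution :: "real \<Rightarrow> distribution \<Rightarrow> distribution" is "\<lambda>c T \<phi>. c * T \<phi>"
  by (auto simp: linear_iff algebra_simps intro!: tendsto_intros)

instance
  by (standard; transfer) (simp_all add: fun_eq_iff algebra_simps)

end

lift_definition dist_deriv :: "nat \<Rightarrow> distribution \<Rightarrow> distribution"
  is "\<lambda>n T \<phi>. (- 1) ^ n * T ((test_deriv ^^ n) \<phi>)"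
  subgoal for n T
    using linear_compose[OF linear_test_deriv_funpow[of n], of T] test_conv_deriv_funpow[of _ _ n]
    by (auto simp: linear_iff algebra_simps intro!: tendsto_intros)
  done

lift_definition dist_translate :: "real \<Rightarrow> distribution \<Rightarrow> distribution"
  is "\<lambda>t T \<phi>. T (test_translate (- t) \<phi>)"
  subgoal for t T
    using linear_compose[OF linear_test_translate[of "- t"], of T] test_conv_translate[of _ _ "- t"]
    by (auto simp: o_def)
  done

definition locally_integrable :: "(real \<Rightarrow> real) \<Rightarrow> bool" where
  "locally_integrable g \<longleftrightarrow> (\<forall>K. compact K \<longrightarrow> set_integrable lebesgue K g)"

lemma integrable_mult_test:
  assumes "locally_integrable g"
  shows "integrable lebesgue (\<lambda>x. g x * apply_test \<phi> x)"
proof -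
  let ?K = "supp (apply_test \<phi>)"
  have \<phi>: "smooth (apply_test \<phi>)" "compact ?K"
    using apply_test[of \<phi>] by auto
  have cont: "continuous_on UNIV (apply_test \<phi>)"
    using smooth_DERIV[OF \<phi>(1), of 0]
    by (auto simp: continuous_on_eq_continuous_at intro!: DERIV_isCont)
  have out: "apply_test \<phi> x = 0" if "x \<notin> ?K" for x
    using that closure_subset[of "{x. apply_test \<phi> x \<noteq> 0}"] by (auto simp: supp_def)
  have "bounded (apply_test \<phi> ` ?K)"
    using compact_continuous_image[OF continuous_on_subset[OF cont] \<phi>(2)] compact_imp_bounded by blast
  then obtain B where B: "B > 0" "\<And>x. x \<in> ?K \<Longrightarrow> \<bar>apply_test \<phi> x\<bar> \<le> B"
    by (auto simp: bounded_pos)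
  have int: "integrable lebesgue (\<lambda>x. indicator ?K x * g x)"
    using assms \<phi>(2) by (simp add: locally_integrable_def set_integrable_def)
  have meas: "(\<lambda>x. (indicator ?K x * g x) * apply_test \<phi> x) \<in> borel_measurable lebesgue"
    using borel_measurable_continuous_onI[OF cont]
    by (intro borel_measurable_times[OF borel_measurable_integrable[OF int]] measurable_completion) simp
  have eq: "(indicator ?K x * g x) * apply_test \<phi> x = g x * apply_test \<phi> x" for x
    using out[of x] by (auto simp: indicator_def)
  have "integrable lebesgue (\<lambda>x. (indicator ?K x * g x) * apply_test \<phi> x)"
  proof (rule Bochner_Integration.integrable_bound[OF _ meas])
    show "integrable lebesgue (\<lambda>x. B * (indicator ?K x * g x))"
      using int by simp
    have "norm ((indicator ?K x * g x) * apply_test \<phi> x) \<le> norm (B * (indicator ?K x * g x))" for x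
      using B(1) mult_right_mono[OF B(2)[of x] abs_ge_zero[of "g x"]]
      by (auto simp: indicator_def abs_mult mult.commute)
    then show "AE x in lebesgue. norm ((indicator ?K x * g x) * apply_test \<phi> x)
        \<le> norm (B * (indicator ?K x * g x))"
      by simp
  qed
  then show ?thesis by (simp add: eq)
qed

lemma regular_functional_tendsto:
  assumes g: "locally_integrable g" and conv: "test_conv \<phi>s \<phi>"
  shows "(\<lambda>j. LINT x|lebesgue. g x * apply_test (\<phi>s j) x) \<longlonglongrightarrow> (LINT x|lebesgue. g x * apply_test \<phi> x)"
proof -
  obtain K where K: "compact K" "\<And>j. supp (apply_test (\<phi>s j)) \<subseteq> K" "supp (apply_test \<phi>) \<subseteq> K"
    using conv by (auto simp: test_conv_def)
  have unif: "uniform_limit UNIV (\<lambda>j. apply_test (\<phi>s j)) (apply_test \<phi>) sequentially"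
    using conv unfolding test_conv_def by (elim conjE allE[of _ 0]) simp
  have int: "integrable lebesgue (\<lambda>x. \<bar>indicator K x * g x\<bar>)"
    using g K(1) by (auto simp: locally_integrable_def set_integrable_def)
  define C where "C = (LINT x|lebesgue. \<bar>indicator K x * g x\<bar>)"
  have C: "C \<ge> 0" unfolding C_def by simp
  have out: "apply_test \<psi> x = 0" if "x \<notin> K" "supp (apply_test \<psi>) \<subseteq> K" for \<psi> x
    using that closure_subset[of "{x. apply_test \<psi> x \<noteq> 0}"] by (auto simp: supp_def)
  have bound: "\<bar>(LINT x|lebesgue. g x * apply_test (\<phi>s j) x) - (LINT x|lebesgue. g x * apply_test \<phi> x)\<bar>
      \<le> e * C"
    if e: "\<And>x. \<bar>apply_test (\<phi>s j) x - apply_test \<phi> x\<bar> \<le> e" for j e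
  proof -
    have pt: "norm (g x * apply_test (\<phi>s j) x - g x * apply_test \<phi> x) \<le> e * \<bar>indicator K x * g x\<bar>" for x
    proof (cases "x \<in> K")
      case True
      have "norm (g x * apply_test (\<phi>s j) x - g x * apply_test \<phi> x)
          = \<bar>apply_test (\<phi>s j) x - apply_test \<phi> x\<bar> * \<bar>g x\<bar>"
        by (simp flip: right_diff_distrib add: abs_mult)
      also have "\<dots> \<le> e * \<bar>g x\<bar>"
        by (rule mult_right_mono[OF e]) simp
      finally show ?thesis using True by simp
    next
      case False
      then show ?thesis using out[OF False K(2)] out[OF False K(3)] by simp
    qed
    have i: "integrable lebesgue (\<lambda>x. g x * apply_test (\<phi>s j) x - g x * apply_test \<phi> x)"
      by (intro Bochner_Integration.integrable_diff integrable_mult_test g)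
    have "norm (LINT x|lebesgue. g x * apply_test (\<phi>s j) x - g x * apply_test \<phi> x)
        \<le> (LINT x|lebesgue. norm (g x * apply_test (\<phi>s j) x - g x * apply_test \<phi> x))"
      by (rule integral_norm_bound)
    also have "\<dots> \<le> (LINT x|lebesgue. e * \<bar>indicator K x * g x\<bar>)"
      using i int pt by (intro integral_mono) auto
    also have "\<dots> = e * C" by (simp add: C_def)
    finally show ?thesis
      using integrable_mult_test[OF g] by (simp add: Bochner_Integration.integral_diff)
  qed
  show ?thesis
  proof (rule LIMSEQ_I)
    fix r :: real assume r: "r > 0"
    define e where "e = r / (C + 1)"
    have e: "e > 0" "e * C < r"
      using r C by (simp_all add: e_def field_simps)
    obtain N where "\<forall>j\<ge>N. \<forall>x. dist (apply_test (\<phi>s j) x) (apply_test \<phi> x) < e"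
      using uniform_limitD[OF unif e(1)] by (auto simp: eventually_sequentially)
    then have "\<forall>j\<ge>N. \<forall>x. \<bar>apply_test (\<phi>s j) x - apply_test \<phi> x\<bar> \<le> e"
      by (auto simp: dist_real_def intro: less_imp_le)
    then show "\<exists>N. \<forall>j\<ge>N. norm ((LINT x|lebesgue. g x * apply_test (\<phi>s j) x)
        - (LINT x|lebesgue. g x * apply_test \<phi> x)) < r"
      unfolding real_norm_def by (blast intro: le_less_trans[OF bound e(2)])
  qed
qed

text \<open>The distribution defined by a locally integrable function; by convention zero for all other
  functions.\<close>

lift_definition of_fun :: "(real \<Rightarrow> real) \<Rightarrow> distribution"
  is "\<lambda>g \<phi>. if locally_integrable g then LINT x|lebesgue. g x * apply_test \<phi> x else 0"
  subgoal for g
    using integrable_mult_test[of g] regular_functional_tendsto[of g]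
    by (auto simp: linear_iff plus_test_fun.rep_eq scaleR_test_fun.rep_eq distrib_left
        mult.left_commute[of "g _"])
  done

definition smooth_distributions :: "distribution set" where
  "smooth_distributions = {of_fun g |g. smooth g}"

definition order_at_most :: "nat \<Rightarrow> distribution \<Rightarrow> bool" where
  "order_at_most n T \<longleftrightarrow>
     (\<forall>K. compact K \<longrightarrow> (\<exists>C\<ge>0. \<forall>\<phi>. supp (apply_test \<phi>) \<subseteq> K \<longrightarrow>
        \<bar>\<langle>T, \<phi>\<rangle>\<bar> \<le> C * (\<Sum>k\<le>n. sup_norm ((deriv ^^ k) (apply_test \<phi>)))))"

definition schwartz :: "(real \<Rightarrow> real) set" where
  "schwartz = {\<phi>. smooth \<phi> \<and> (\<forall>m k. bounded (range (\<lambda>x. x ^ m * (deriv ^^ k) \<phi> x)))}"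

definition schwartz_conv :: "(nat \<Rightarrow> real \<Rightarrow> real) \<Rightarrow> (real \<Rightarrow> real) \<Rightarrow> bool" where
  "schwartz_conv \<phi>s \<phi> \<longleftrightarrow>
     (\<forall>m k. uniform_limit UNIV (\<lambda>j x. x ^ m * (deriv ^^ k) (\<phi>s j) x)
                                (\<lambda>x. x ^ m * (deriv ^^ k) \<phi> x) sequentially)"

text \<open>A distribution is tempered if it is the restriction of a continuous linear functional on the
  Schwartz space.  That space is metrizable, so sequential continuity suffices.\<close>

definition tempered :: "distribution \<Rightarrow> bool" where
  "tempered T \<longleftrightarrow>
     (\<exists>S. (\<forall>a b. \<forall>\<phi>\<in>schwartz. \<forall>\<psi>\<in>schwartz. S (a *\<^sub>R \<phi> + b *\<^sub>R \<psi>) = a * S \<phi> + b * S \<psi>) \<and>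
          (\<forall>\<phi>s \<phi>. range \<phi>s \<subseteq> schwartz \<longrightarrow> \<phi> \<in> schwartz \<longrightarrow> schwartz_conv \<phi>s \<phi> \<longrightarrow>
             (\<lambda>j. S (\<phi>s j)) \<longlonglongrightarrow> S \<phi>) \<and>
          (\<forall>\<phi>. \<langle>T, \<phi>\<rangle> = S (apply_test \<phi>)))"


section \<open>Regulated functions and their distributional derivatives\<close>

definition regulated :: "(ereal \<Rightarrow> real) \<Rightarrow> bool" where
  "regulated F \<longleftrightarrow>
     (\<forall>x. (\<exists>l. ((F \<circ> ereal) \<longlongrightarrow> l) (at_left x)) \<and> (\<exists>l. ((F \<circ> ereal) \<longlongrightarrow> l) (at_right x))) \<and>
     ((F \<circ> ereal) \<longlongrightarrow> F \<infinity>) at_top \<and> ((F \<circ> ereal) \<longlongrightarrow> F (- \<infinity>)) at_bot"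

definition B_r :: "(ereal \<Rightarrow> real) set" where
  "B_r = {F. regulated F \<and> F (- \<infinity>) = 0 \<and> (\<forall>x. ((F \<circ> ereal) \<longlongrightarrow> F (ereal x)) (at_left x))}"

definition B_c :: "(ereal \<Rightarrow> real) set" where
  "B_c = {F. continuous_on UNIV F \<and> F (- \<infinity>) = 0}"

definition B_norm :: "(ereal \<Rightarrow> real) \<Rightarrow> real" where
  "B_norm F = sup_norm (F \<circ> ereal)"

definition A_r :: "nat \<Rightarrow> distribution set" where
  "A_r n = {f. \<exists>F\<in>B_r. f = dist_deriv n (of_fun (F \<circ> ereal))}"

definition A_c :: "nat \<Rightarrow> distribution set" where
  "A_c n = {f. \<exists>F\<in>B_c. f = dist_deriv n (of_fun (F \<circ> ereal))}"

text \<open>Since \<open>B_c \<subseteq> B_r\<close>, this is also the primitive for elements of \<open>A_c n\<close>.\<close>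

definition primitive :: "nat \<Rightarrow> distribution \<Rightarrow> ereal \<Rightarrow> real" where
  "primitive n f = (THE F. F \<in> B_r \<and> f = dist_deriv n (of_fun (F \<circ> ereal)))"

definition A_norm :: "nat \<Rightarrow> distribution \<Rightarrow> real" where
  "A_norm n f = B_norm (primitive n f)"

end

theory Submission
  imports Defs "HOL-Computational_Algebra.Polynomial" "HOL-Probability.Sinc_Integral"
begin

text \<open>A distribution with vanishing derivative is constant, so every solution of \<open>T\<^bsup>(n)\<^esup> = g\<close> is a smooth
  function if \<open>g\<close> is smooth, and a polynomial if \<open>g = 0\<close>.  A polynomial with limit 0 at \<open>-\<infinity>\<close>
  vanishes, and left continuity removes the ambiguity on null sets.  Hence
  \<open>F \<mapsto> F\<^bsup>(n)\<^esup>\<close> is a linear isometry of \<open>B_r\<close> onto \<open>A_r n\<close> that commutes with translations, and all metric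
  claims reduce to the supremum norm.  There, \<open>tanh\<close> turns \<open>B_c\<close> into the continuous functions on
  \<open>[-1, 1]\<close> that vanish at \<open>-1\<close>, and Stone--Weierstrass yields separability, the smooth approximations and the continuity of
  translations.  The step functions \<open>1\<^bsub>(a, \<infinity>]\<^esub>\<close> are mutually at distance 1, so \<open>B_r\<close> is not separable.
  A smooth element of \<open>A_r n\<close> has a continuous primitive, which stays at distance at least \<open>1/2\<close>
  from a step function.\<close>

section \<open>Smooth functions\<close>

text \<open>A distributional derivative probes \<open>T\<close> only on test functions of the form
  \<open>test_deriv \<psi>\<close>. These are exactly the test functions of integral 0, a
  hyperplane, so the value of \<open>T\<close> on a single bump of positive integral settles the
  rest: this is why T' = 0 leaves only constants. Bumps also detect where two left continuous
  functions differ.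

  Polynomials in tanh are chosen because three demands meet in one algebra. On the compact space
  \<open>ereal\<close> they separate points; they are smooth, since tanh' = 1 - tanh^2 keeps
  derivatives inside the algebra; and those derivatives are bounded, so that each of these functions
  is Lipschitz and its translates converge uniformly.

  Order and temperedness rest on the boundedness of the primitive: it reduces the pairing to an
  estimate of the n-th derivative of the test function alone, integrated over a compact set in one
  case and dominated by the integrable weight 1 / (1 + x^2) in the other.\<close>

text \<open>\<open>smooth\<close> quantifies over all iterates of \<open>deriv\<close>. Closure
  keeps each iterate inside \<open>S\<close>, so no formula for higher derivatives is ever computed;
  the smoothness proofs below merely choose a suitable \<open>S\<close>.\<close>

lemma deriv_closed_imp_smooth:
  assumes "f \<in> S" and closed: "\<And>g. g \<in> S \<Longrightarrow> \<exists>g'\<in>S. \<forall>x. (g has_real_derivative g' x) (at x)"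
  shows "smooth f"
proof (rule smoothI)
  have *: "(deriv ^^ k) f \<in> S" for k
  proof (induction k)
    case (Suc k)
    then obtain g' where "g' \<in> S" "\<forall>x. ((deriv ^^ k) f has_real_derivative g' x) (at x)"
      using closed by blast
    moreover from this have "deriv ((deriv ^^ k) f) = g'"
      by (intro ext DERIV_imp_deriv) auto
    ultimately show ?case by simp
  qed (use assms in simp)
  show "((deriv ^^ k) f has_real_derivative deriv ((deriv ^^ k) f) x) (at x)" for k x
    using closed[OF *[of k]] DERIV_imp_deriv by metis
qed

lemma smooth_has_deriv: "smooth g \<Longrightarrow> (g has_real_derivative deriv g x) (at x)"
  using smooth_DERIV[of g 0 x] by simp

lemma continuous_on_smooth: "smooth g \<Longrightarrow> continuous_on A g"
  using smooth_has_deriv by (blast intro: DERIV_isCont continuous_at_imp_continuous_on)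

lemma smooth_higher_deriv: "smooth g \<Longrightarrow> smooth ((deriv ^^ k) g)"
  by (induction k) (simp_all add: smooth_deriv)

text \<open>The product rule turns one product into a sum of two, so the set \<open>B\<close> of
  products is not visibly closed under differentiation, but its linear span is.\<close>

lemma smooth_mult:
  assumes "smooth f" "smooth g"
  shows "smooth (\<lambda>x. f x * g x)"
proof -
  define B where "B = {\<lambda>x. f x * g x |f g. smooth f \<and> smooth g}"
  have "(\<lambda>x. f x * g x) \<in> span B"
    using assms by (intro span_base) (auto simp: B_def)
  then show ?thesis
  proof (rule deriv_closed_imp_smooth)
    let ?P = "\<lambda>h. \<exists>h'\<in>span B. \<forall>x. (h has_real_derivative h' x) (at x)"
    fix h assume "h \<in> span B"
    then show "?P h"
    proof (rule span_induct)
      show "subspace {h. ?P h}"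
      proof (rule subspaceI)
        show "0 \<in> {h. ?P h}"
          by (auto intro!: bexI[of _ 0] span_zero simp: zero_fun_def)
        show "f + g \<in> {h. ?P h}" if fg: "f \<in> {h. ?P h}" "g \<in> {h. ?P h}" for f g
        proof -
          obtain f' g' where "f' \<in> span B" "g' \<in> span B"
            and "\<And>x. (f has_real_derivative f' x) (at x)" "\<And>x. (g has_real_derivative g' x) (at x)"
            using fg by blast
          then show ?thesis
            by (auto intro!: bexI[of _ "f' + g'"] span_add DERIV_add simp: plus_fun_def)
        qed
        show "c *\<^sub>R f \<in> {h. ?P h}" if "f \<in> {h. ?P h}" for c f
        proof -
          obtain f' where "f' \<in> span B" and "\<And>x. (f has_real_derivative f' x) (at x)"
            using \<open>f \<in> _\<close> by blast
          then show ?thesis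
            by (auto intro!: bexI[of _ "c *\<^sub>R f'"] span_scale DERIV_cmult simp: scaleR_fun_def)
        qed
      qed
      fix h assume "h \<in> B"
      then obtain f g where h: "h = (\<lambda>x. f x * g x)" "smooth f" "smooth g"
        by (auto simp: B_def)
      have "(\<lambda>x. f x * deriv g x) \<in> B" "(\<lambda>x. deriv f x * g x) \<in> B"
        unfolding B_def using h smooth_deriv by blast+
      then have "(\<lambda>x. f x * deriv g x) + (\<lambda>x. deriv f x * g x) \<in> span B"
        by (intro span_add span_base)
      moreover have "(h has_real_derivative f x * deriv g x + deriv f x * g x) (at x)" for x
        unfolding h by (auto intro!: derivative_eq_intros smooth_has_deriv h)
      ultimately show "?P h"
        by (intro bexI[of _ "(\<lambda>x. f x * deriv g x) + (\<lambda>x. deriv f x * g x)"]) auto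
    qed
  qed
qed

lemma smooth_compose_affine:
  assumes "smooth f"
  shows "smooth (\<lambda>x. f (m * x + c))"
proof (rule deriv_closed_imp_smooth)
  \<comment> \<open>The scalar \<open>a\<close> absorbs the factor \<open>m\<close> that each use of
    the chain rule adds.\<close>
  define S where "S = {\<lambda>x. a * g (m * x + c) |a g. smooth g}"
  show "(\<lambda>x. f (m * x + c)) \<in> S"
    unfolding S_def using assms by (intro CollectI exI[of _ "1::real"] exI[of _ f]) simp
  fix h assume "h \<in> S"
  then obtain a g where h: "h = (\<lambda>x. a * g (m * x + c))" "smooth g"
    by (auto simp: S_def)
  have "(h has_real_derivative (a * m) * deriv g (m * x + c)) (at x)" for x
    unfolding h(1)
    by (auto intro!: derivative_eq_intros DERIV_chain2[OF smooth_has_deriv[OF h(2)]])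
  then show "\<exists>h'\<in>S. \<forall>x. (h has_real_derivative h' x) (at x)"
    unfolding S_def using smooth_deriv[OF h(2)]
    by (intro bexI[of _ "\<lambda>x. (a * m) * deriv g (m * x + c)"] CollectI allI) blast+
qed

lemma smooth_antiderivative:
  assumes "smooth g" "\<And>x. (G has_real_derivative g x) (at x)"
  shows "smooth G"
proof (rule deriv_closed_imp_smooth[of _ "insert G (Collect smooth)"])
  show "\<exists>h'\<in>insert G (Collect smooth). \<forall>x. (h has_real_derivative h' x) (at x)"
    if "h \<in> insert G (Collect smooth)" for h
    using that assms smooth_has_deriv smooth_deriv by blast
qed simp

lemma continuous_antiderivative:
  fixes g :: "real \<Rightarrow> real"
  assumes "continuous_on UNIV g"
  obtains G where "\<And>x. (G has_real_derivative g x) (at x)"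
  using einterval_antiderivative[of "-\<infinity>" \<infinity> g] assms
  by (auto simp: continuous_on_eq_continuous_at has_real_derivative_iff_has_vector_derivative)

lemma smooth_const: "smooth (\<lambda>x. c)"
  by (rule smooth_antiderivative[OF smooth_zero]) simp

lemma smooth_poly: "smooth (poly p)"
  by (rule deriv_closed_imp_smooth[of _ "range poly"]) (auto intro: poly_DERIV)

text \<open>\<open>[:1, 0, -1:]\<close> is the polynomial 1 - s^2, which expresses tanh' = 1 -
  tanh^2. The result is again a polynomial in tanh, which gives smoothness and, later, a Lipschitz
  bound.\<close>

lemma DERIV_poly_tanh:
  fixes p :: "real poly"
  shows "((\<lambda>x. poly p (tanh x)) has_real_derivative poly (pderiv p * [:1, 0, -1:]) (tanh x)) (at x)"
  by (auto intro!: derivative_eq_intros DERIV_chain2[OF poly_DERIV]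
      simp: power2_eq_square algebra_simps)

lemma smooth_poly_tanh: "smooth (\<lambda>x. poly p (tanh x))"
proof (rule deriv_closed_imp_smooth[of _ "range (\<lambda>p x. poly p (tanh x))"])
  fix h :: "real \<Rightarrow> real" assume "h \<in> range (\<lambda>p x. poly p (tanh x))"
  then obtain p where "h = (\<lambda>x. poly p (tanh x))"
    by blast
  then show "\<exists>h'\<in>range (\<lambda>p x. poly p (tanh x)). \<forall>x. (h has_real_derivative h' x) (at x)"
    using DERIV_poly_tanh[of p]
    by (intro bexI[of _ "\<lambda>x. poly (pderiv p * [:1, 0, -1:]) (tanh x)"] rangeI allI) simp_all
qed blast


section \<open>Bump functions\<close>

lemma tendsto_poly_mult_exp_minus:
  fixes p :: "real poly"
  shows "((\<lambda>u. poly p u * exp (- u)) \<longlongrightarrow> 0) at_top"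
proof -
  have "((\<lambda>u. \<Sum>i\<le>degree p. coeff p i * (u ^ i / exp u)) \<longlongrightarrow> (\<Sum>i\<le>degree p. coeff p i * 0)) at_top"
    by (intro tendsto_intros tendsto_power_div_exp_0)
  then show ?thesis
    by (simp add: poly_altdef sum_distrib_right exp_minus divide_inverse mult.assoc)
qed

text \<open>The parameter \<open>p\<close> makes the family closed under differentiation; only \<open>flat 1\<close> enters the bumps.\<close>

definition flat :: "real poly \<Rightarrow> real \<Rightarrow> real" where
  "flat p x = (if x > 0 then poly p (inverse x) * exp (- inverse x) else 0)"

text \<open>With u = 1 / x one has d/dx = - u^2 d/du, which sends p(u) exp(-u) to u^2 (p - p')(u)
  exp(-u); hence the new polynomial. Only the point 0 needs a limit argument.\<close>

lemma flat_has_derivative: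
  "(flat p has_real_derivative flat (monom 1 2 * (p - pderiv p)) x) (at x)"
proof (cases x "0 :: real" rule: linorder_cases)
  case greater
  have "((\<lambda>x. poly p (inverse x) * exp (- inverse x))
      has_real_derivative poly (monom 1 2 * (p - pderiv p)) (inverse x) * exp (- inverse x)) (at x)"
    using greater by (auto intro!: derivative_eq_intros DERIV_chain2[OF poly_DERIV]
        simp: poly_monom power2_eq_square algebra_simps)
  then have "(flat p has_real_derivative
      poly (monom 1 2 * (p - pderiv p)) (inverse x) * exp (- inverse x)) (at x)"
    by (rule has_field_derivative_transform_within_open[of _ _ _ "{0<..}"])
      (use greater in \<open>auto simp: flat_def\<close>)
  then show ?thesis
    using greater by (simp add: flat_def)
next
  case less
  have "(flat p has_real_derivative 0) (at x)"
    by (rule has_field_derivative_transform_within_open[OF DERIV_const, of "{..<0}" _ 0])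
      (use less in \<open>auto simp: flat_def\<close>)
  then show ?thesis
    using less by (simp add: flat_def)
next
  case equal
  have "((\<lambda>h. flat p h / h) \<longlongrightarrow> 0) (at 0)"
  proof (rule filterlim_split_at_real)
    show "((\<lambda>h. flat p h / h) \<longlongrightarrow> 0) (at_left 0)"
      by (rule tendsto_eventually) (auto simp: flat_def eventually_at_filter)
    \<comment> \<open>Dividing by h multiplies by u = 1 / h, and \<open>pCons 0 p\<close> is u *
      p(u): the difference quotient has the same shape as \<open>flat\<close>, and exponential decay
      beats the polynomial.\<close>
    have "((\<lambda>h. poly (pCons 0 p) (inverse h) * exp (- inverse h)) \<longlongrightarrow> 0) (at_right 0)"
      by (rule filterlim_compose[OF tendsto_poly_mult_exp_minus filterlim_inverse_at_top_right])
    moreover have "\<forall>\<^sub>F h in at_right 0.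
        poly (pCons 0 p) (inverse h) * exp (- inverse h) = flat p h / h"
      unfolding eventually_at_filter by (auto simp: flat_def divide_inverse)
    ultimately show "((\<lambda>h. flat p h / h) \<longlongrightarrow> 0) (at_right 0)"
      by (rule Lim_transform_eventually)
  qed
  then show ?thesis
    using equal by (simp add: has_field_derivative_iff flat_def)
qed

lemma smooth_flat: "smooth (flat p)"
  by (rule deriv_closed_imp_smooth[of _ "range flat"]) (use flat_has_derivative in blast)+

lemma smooth_test: "smooth (apply_test \<phi>)"
  and compact_supp_test: "compact (supp (apply_test \<phi>))"
  using apply_test[of \<phi>] by auto

lemma not_in_supp: "x \<notin> supp g \<Longrightarrow> g x = 0"
  using closure_subset[of "{x. g x \<noteq> 0}"] by (auto simp: supp_def)

lemma compact_suppI: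
  assumes "compact K" "\<And>x. x \<notin> K \<Longrightarrow> g x = 0"
  shows "compact (supp g)"
proof -
  have "supp g \<subseteq> K"
    unfolding supp_def using assms by (intro closure_minimal) (auto intro: compact_imp_closed)
  then show ?thesis
    using assms(1) by (metis closed_closure compact_Int_closed inf.absorb_iff2 supp_def)
qed

lemma exists_bump:
  fixes a b :: real
  assumes "a < b"
  obtains \<rho> where "\<And>x. apply_test \<rho> x \<ge> 0" "\<And>x. apply_test \<rho> x > 0 \<longleftrightarrow> a < x \<and> x < b"
proof -
  \<comment> \<open>One factor is positive exactly to the right of \<open>a\<close>, the other
    exactly to the left of \<open>b\<close>; the unsimplified arguments match
    \<open>smooth_compose_affine\<close>.\<close>
  define g where "g = (\<lambda>x. flat 1 (1 * x + (- a)) * flat 1 ((- 1) * x + b))"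
  have "smooth g"
    unfolding g_def by (intro smooth_mult smooth_compose_affine smooth_flat)
  moreover have "compact (supp g)"
    by (rule compact_suppI[of "{a..b}"]) (auto simp: g_def flat_def)
  ultimately have "apply_test (Abs_test_fun g) = g"
    by (simp add: Abs_test_fun_inverse)
  moreover have "g x \<ge> 0" "g x > 0 \<longleftrightarrow> a < x \<and> x < b" for x
    by (auto simp: g_def flat_def)
  ultimately show thesis
    using that by metis
qed


section \<open>Distributions defined by functions\<close>

lemma distribution_eqI: "(\<And>\<phi>. \<langle>S, \<phi>\<rangle> = \<langle>T, \<phi>\<rangle>) \<Longrightarrow> S = T"
  by (simp add: pairing_inject[symmetric] fun_eq_iff)

lemma pairing_of_fun:
  "locally_integrable g \<Longrightarrow> \<langle>of_fun g, \<phi>\<rangle> = (LINT x|lebesgue. g x * apply_test \<phi> x)"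
  by (simp add: of_fun.rep_eq)

lemma linear_pairing: "linear (pairing T)"
  using pairing[of T] by simp

lemma locally_integrable_lincomb:
  assumes "locally_integrable f" "locally_integrable g"
  shows "locally_integrable (\<lambda>x. a * f x + b * g x)"
  using assms unfolding locally_integrable_def
  by (auto intro!: set_integral_add set_integrable_mult_right)

lemma of_fun_lincomb:
  assumes "locally_integrable f" "locally_integrable g"
  shows "of_fun (\<lambda>x. a * f x + b * g x) = a *\<^sub>R of_fun f + b *\<^sub>R of_fun g"
  using integrable_mult_test assms
  by (intro distribution_eqI)
    (simp add: pairing_of_fun locally_integrable_lincomb plus_distribution.rep_eq
      scaleR_distribution.rep_eq distrib_right mult.assoc)

lemma locally_integrable_bounded:
  assumes "g \<in> borel_measurable borel" "\<And>K. compact K \<Longrightarrow> bounded (g ` K)"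
  shows "locally_integrable g"
  unfolding locally_integrable_def
proof (intro allI impI)
  fix K :: "real set" assume K: "compact K"
  obtain B where "\<And>x. x \<in> K \<Longrightarrow> norm (g x) \<le> B"
    using assms(2)[OF K] by (auto simp: bounded_iff)
  moreover have "K \<in> lmeasurable" using K by (rule lmeasurable_compact)
  moreover have "g \<in> borel_measurable lebesgue"
    using assms(1) by (intro measurable_completion) simp
  ultimately show "set_integrable lebesgue K g"
    unfolding set_integrable_def
    by (intro integrableI_bounded_set[where A=K and B=B])
      (auto simp: fmeasurable_def indicator_def)
qed

lemma locally_integrable_continuous:
  fixes g :: "real \<Rightarrow> real"
  assumes "continuous_on UNIV g"
  shows "locally_integrable g"
proof (rule locally_integrable_bounded)
  show "g \<in> borel_measurable borel"
    using assms by (rule borel_measurable_continuous_onI)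
  show "bounded (g ` K)" if "compact K" for K
    using that assms by (intro compact_imp_bounded compact_continuous_image continuous_on_subset[OF assms]) auto
qed

lemma locally_integrable_smooth: "smooth g \<Longrightarrow> locally_integrable g"
  by (intro locally_integrable_continuous continuous_on_smooth)

section \<open>Integration by parts and compatibility with classical derivatives\<close>

lemma integral_deriv_compact_support:
  fixes h h' :: "real \<Rightarrow> real"
  assumes h: "\<And>x. (h has_real_derivative h' x) (at x)" and cont: "continuous_on UNIV h'"
    and K: "compact K" "\<And>x. x \<notin> K \<Longrightarrow> h x = 0"
  shows "(LINT x|lebesgue. h' x) = 0"
proof -
  obtain r where r: "r > 0" "\<And>x. x \<in> K \<Longrightarrow> \<bar>x\<bar> \<le> r"
    using compact_imp_bounded[OF K(1)] unfolding bounded_pos by auto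
  \<comment> \<open>The extra 1 puts both endpoints outside \<open>K\<close>, so the boundary terms
    of the fundamental theorem vanish.\<close>
  define a where "a = r + 1"
  have a: "a > 0" "a \<notin> K" "- a \<notin> K"
    using r by (force simp: a_def)+
  have h'0: "h' x = 0" if "x \<notin> K" for x
  proof -
    have "(h has_real_derivative 0) (at x)"
      using K that
      by (intro has_field_derivative_transform_within_open[OF DERIV_const, of "- K" _ 0])
        (auto intro: compact_imp_closed)
    then show ?thesis using h DERIV_unique by blast
  qed
  have "(LINT x|lebesgue. h' x) = (LINT x|lborel. h' x)"
    using borel_measurable_continuous_onI[OF cont] by (intro integral_completion) simp
  also have "\<dots> = (LINT x|lborel. h' x * indicator {-a..a} x)"
    using h'0 r by (intro Bochner_Integration.integral_cong) (force simp: indicator_def a_def)+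
  also have "\<dots> = h a - h (- a)"
    using a h cont
    by (intro integral_FTC_Icc_real) (auto simp: continuous_on_eq_continuous_at)
  finally show ?thesis using a K by simp
qed

text \<open>Integration by parts: the derivative of g * \<phi> has integral 0 because \<phi> has
  compact support.\<close>

lemma dist_deriv_of_fun:
  assumes g: "\<And>x. (g has_real_derivative g' x) (at x)" and cont: "continuous_on UNIV g'"
  shows "dist_deriv 1 (of_fun g) = of_fun g'"
proof (rule distribution_eqI)
  fix \<phi>
  have contg: "continuous_on UNIV g"
    using g by (blast intro: DERIV_isCont continuous_at_imp_continuous_on)
  note li = locally_integrable_continuous[OF contg] locally_integrable_continuous[OF cont]
  have "(LINT x|lebesgue. g x * deriv (apply_test \<phi>) x + g' x * apply_test \<phi> x) = 0"
  proof (rule integral_deriv_compact_support)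
    show "((\<lambda>x. g x * apply_test \<phi> x) has_real_derivative
        g x * deriv (apply_test \<phi>) x + g' x * apply_test \<phi> x) (at x)" for x
      by (auto intro!: derivative_eq_intros g smooth_has_deriv smooth_test)
    show "continuous_on UNIV (\<lambda>x. g x * deriv (apply_test \<phi>) x + g' x * apply_test \<phi> x)"
      by (intro continuous_intros contg cont continuous_on_smooth smooth_test smooth_deriv)
    show "compact (supp (apply_test \<phi>))" by (rule compact_supp_test)
  qed (simp add: not_in_supp)
  moreover have "integrable lebesgue (\<lambda>x. g x * deriv (apply_test \<phi>) x)"
    using integrable_mult_test[OF li(1), of "test_deriv \<phi>"] by (simp add: test_deriv.rep_eq)
  ultimately show "\<langle>dist_deriv 1 (of_fun g), \<phi>\<rangle> = \<langle>of_fun g', \<phi>\<rangle>"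
    using integrable_mult_test[OF li(2), of \<phi>]
    by (simp add: dist_deriv.rep_eq pairing_of_fun li test_deriv.rep_eq)
qed

lemma dist_deriv_add: "dist_deriv (m + n) T = dist_deriv m (dist_deriv n T)"
  by (rule distribution_eqI) (simp add: dist_deriv.rep_eq power_add add.commute[of m] funpow_add)

lemma dist_deriv_0 [simp]: "dist_deriv 0 T = T"
  by (rule distribution_eqI) (simp add: dist_deriv.rep_eq)

lemma linear_dist_deriv: "linear (dist_deriv n)"
  by (rule linearI; rule distribution_eqI)
    (simp_all add: dist_deriv.rep_eq plus_distribution.rep_eq scaleR_distribution.rep_eq algebra_simps)

lemma dist_deriv_of_fun_smooth:
  "smooth g \<Longrightarrow> dist_deriv n (of_fun g) = of_fun ((deriv ^^ n) g)"
proof (induction n)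
  case (Suc n)
  have "dist_deriv (Suc n) (of_fun g) = dist_deriv 1 (of_fun ((deriv ^^ n) g))"
    using dist_deriv_add[of 1 n] Suc by simp
  also have "\<dots> = of_fun ((deriv ^^ Suc n) g)"
    by (rule dist_deriv_of_fun)
      (simp_all add: smooth_has_deriv smooth_higher_deriv continuous_on_smooth smooth_deriv Suc.prems)
  finally show ?case .
qed simp

section \<open>Solving T' = g and its iterates among distributions\<close>

text \<open>Any antiderivative is constant on either side of the support. The vanishing integral
  says that the two constants agree, so subtracting their common value \<open>G r\<close> leaves a
  function of compact support.\<close>

lemma test_antiderivative:
  assumes "(LINT x|lebesgue. apply_test \<phi> x) = 0"
  obtains \<psi> where "\<phi> = test_deriv \<psi>"
proof -
  let ?\<phi> = "apply_test \<phi>"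
  have cont: "continuous_on UNIV ?\<phi>"
    by (rule continuous_on_smooth[OF smooth_test])
  obtain G where G: "\<And>x. (G has_real_derivative ?\<phi> x) (at x)"
    using continuous_antiderivative[OF cont] by blast
  obtain r where r: "r > 0" "\<And>x. x \<in> supp ?\<phi> \<Longrightarrow> \<bar>x\<bar> \<le> r"
    using compact_imp_bounded[OF compact_supp_test] unfolding bounded_pos by (metis real_norm_def)
  have out: "?\<phi> x = 0" if "\<bar>x\<bar> > r" for x
    using r that not_in_supp[of x ?\<phi>] by force
  have "0 = (LINT x|lborel. ?\<phi> x)"
    using borel_measurable_continuous_onI[OF cont] assms by (subst (asm) integral_completion) simp_all
  also have "\<dots> = (LINT x|lborel. ?\<phi> x * indicator {-r..r} x)"
    using out by (intro Bochner_Integration.integral_cong) (force simp: indicator_def)+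
  also have "\<dots> = G r - G (- r)"
    using r G cont by (intro integral_FTC_Icc_real) (auto simp: continuous_on_eq_continuous_at)
  finally have eq: "G r = G (- r)" by simp
  define g where "g = (\<lambda>x. G x - G r)"
  have g: "(g has_real_derivative ?\<phi> x) (at x)" for x
    unfolding g_def using G by (auto intro!: derivative_eq_intros)
  have "g x = 0" if "x \<notin> {-r..r}" for x
  proof (cases "x > r")
    case True
    then have "\<exists>z>r. z < x \<and> G x - G r = (x - r) * ?\<phi> z"
      using G by (intro MVT2) auto
    then show ?thesis using out by (force simp: g_def)
  next
    case False
    then have "x < - r" using that by simp
    then have "\<exists>z>x. z < -r \<and> G (- r) - G x = (-r - x) * ?\<phi> z"
      using G by (intro MVT2) auto
    then show ?thesis using out eq by (force simp: g_def)
  qed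
  then have "compact (supp g)"
    by (rule compact_suppI[OF compact_Icc])
  moreover have "smooth g"
    by (rule smooth_antiderivative[OF smooth_test g])
  ultimately have "apply_test (Abs_test_fun g) = g"
    by (simp add: Abs_test_fun_inverse)
  moreover have "deriv g = ?\<phi>"
    using g by (intro ext DERIV_imp_deriv)
  ultimately have "\<phi> = test_deriv (Abs_test_fun g)"
    by (simp add: apply_test_inject[symmetric] test_deriv.rep_eq)
  then show thesis by (rule that)
qed

lemma integrable_test: "integrable lebesgue (apply_test \<phi>)"
  using integrable_mult_test[OF locally_integrable_smooth[OF smooth_const[of 1]]] by simp

lemma AE_lebesgue_ex_interval:
  fixes a b :: real
  assumes "AE x in lebesgue. P x" "a < b"
  shows "\<exists>x\<in>{a<..<b}. P x"
proof (rule ccontr)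
  assume "\<not> ?thesis"
  then have "AE x in lebesgue. x \<notin> {a<..<b}"
    using assms(1) by (auto elim!: AE_mp)
  then have "{a<..<b} \<in> null_sets lebesgue"
    by (simp add: AE_iff_null_sets)
  then show False
    using assms(2) by (simp add: negligible_iff_null_sets[symmetric] open_not_negligible)
qed

lemma integral_pos_of_interval:
  fixes g :: "real \<Rightarrow> real"
  assumes "integrable lebesgue g" "\<And>x. g x \<ge> 0" "a < b" "\<And>x. a < x \<Longrightarrow> x < b \<Longrightarrow> g x > 0"
  shows "(LINT x|lebesgue. g x) > 0"
proof -
  have "(LINT x|lebesgue. g x) \<noteq> 0"
  proof
    assume "(LINT x|lebesgue. g x) = 0"
    then have "AE x in lebesgue. g x = 0"
      using assms by (subst (asm) integral_nonneg_eq_0_iff_AE) auto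
    then obtain x where "x \<in> {a<..<b}" "g x = 0"
      using AE_lebesgue_ex_interval assms(3) by blast
    then show False using assms(4)[of x] by simp
  qed
  then show ?thesis
    using assms(2) by (simp add: order.strict_iff_order)
qed

text \<open>\<open>T\<close> vanishes on derivatives of test functions, hence on all test functions
  of integral 0. Subtracting from \<phi> the multiple of a bump with the same integral shows that
  the pairing with \<phi> is a fixed multiple of the integral of \<phi>.\<close>

lemma dist_deriv_eq_0:
  assumes "dist_deriv 1 T = 0"
  obtains c where "T = of_fun (\<lambda>x. c)"
proof -
  obtain \<rho> where \<rho>: "\<And>x. apply_test \<rho> x \<ge> 0" "\<And>x. apply_test \<rho> x > 0 \<longleftrightarrow> (0::real) < x \<and> x < 1"
    using exists_bump[of 0 1] by auto
  let ?I = "\<lambda>\<phi>. LINT x|lebesgue. apply_test \<phi> x"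
  have I: "?I \<rho> > 0"
    by (rule integral_pos_of_interval[of _ 0 1]) (use \<rho> integrable_test in auto)
  have T': "\<langle>T, test_deriv \<psi>\<rangle> = 0" for \<psi>
    using arg_cong[OF assms, of "\<lambda>S. \<langle>S, \<psi>\<rangle>"]
    by (simp add: dist_deriv.rep_eq zero_distribution.rep_eq)
  have "\<langle>T, \<phi>\<rangle> = (\<langle>T, \<rho>\<rangle> / ?I \<rho>) * ?I \<phi>" for \<phi>
  proof -
    let ?k = "?I \<phi> / ?I \<rho>"
    have "?I (\<phi> - ?k *\<^sub>R \<rho>) = 0"
      using I integrable_test
      by (simp add: minus_test_fun.rep_eq scaleR_test_fun.rep_eq Bochner_Integration.integral_diff)
    then obtain \<psi> where "\<phi> - ?k *\<^sub>R \<rho> = test_deriv \<psi>"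
      by (rule test_antiderivative)
    then have "\<langle>T, \<phi> - ?k *\<^sub>R \<rho>\<rangle> = 0" using T' by simp
    then show ?thesis
      using linear_pairing[of T] by (simp add: linear_diff linear_scale)
  qed
  moreover have "\<langle>of_fun (\<lambda>x. c), \<phi>\<rangle> = c * ?I \<phi>" for c \<phi>
    by (simp add: pairing_of_fun[OF locally_integrable_smooth[OF smooth_const]])
  ultimately have "T = of_fun (\<lambda>x. \<langle>T, \<rho>\<rangle> / ?I \<rho>)"
    by (metis distribution_eqI)
  then show thesis by (rule that)
qed

lemma dist_deriv_eq_of_fun:
  assumes T: "dist_deriv 1 T = of_fun g" and cont: "continuous_on UNIV g"
    and G: "\<And>x. (G has_real_derivative g x) (at x)"
  obtains c where "T = of_fun (\<lambda>x. G x + c)"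
proof -
  have contG: "continuous_on UNIV G"
    using G by (blast intro: DERIV_isCont continuous_at_imp_continuous_on)
  have "dist_deriv 1 (T - of_fun G) = 0"
    using T dist_deriv_of_fun[OF G cont] linear_dist_deriv[of 1] by (simp add: linear_diff)
  then obtain c where c: "T - of_fun G = of_fun (\<lambda>x. c)"
    by (rule dist_deriv_eq_0)
  have "of_fun (\<lambda>x. 1 * G x + 1 * c) = 1 *\<^sub>R of_fun G + 1 *\<^sub>R of_fun (\<lambda>x. c)"
    by (intro of_fun_lincomb locally_integrable_continuous contG continuous_on_const)
  also have "\<dots> = T" using c by (simp flip: c)
  finally show thesis using that[of c] by simp
qed

lemma dist_deriv_eq_of_fun_smooth:
  assumes "dist_deriv n T = of_fun g" "smooth g"
  obtains G where "smooth G" "T = of_fun G"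
proof -
  have "\<exists>G. smooth G \<and> T = of_fun G" using assms
  proof (induction n arbitrary: g)
    case (Suc n)
    obtain G where G: "\<And>x. (G has_real_derivative g x) (at x)"
      using continuous_antiderivative[OF continuous_on_smooth[OF Suc.prems(2)]] by blast
    have "dist_deriv 1 (dist_deriv n T) = of_fun g"
      using Suc.prems dist_deriv_add[of 1 n T] by simp
    then obtain c where c: "dist_deriv n T = of_fun (\<lambda>x. G x + c)"
      using dist_deriv_eq_of_fun[OF _ continuous_on_smooth G] Suc.prems(2) by blast
    have "((\<lambda>x. G x + c) has_real_derivative g x) (at x)" for x
      using G by (auto intro!: derivative_eq_intros)
    then have "smooth (\<lambda>x. G x + c)"
      by (rule smooth_antiderivative[OF Suc.prems(2)])
    then show ?case using Suc.IH c by blast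
  qed auto
  then show thesis using that by blast
qed

lemma poly_antiderivative:
  fixes p :: "real poly"
  shows "\<exists>q. pderiv q = p"
proof -
  define q where "q = (\<Sum>i\<le>degree p. monom (coeff p i / real (Suc i)) (Suc i))"
  have "pderiv q = (\<Sum>i\<le>degree p. monom (coeff p i) i)"
    using higher_pderiv_sum[of 1 "\<lambda>i. monom (coeff p i / real (Suc i)) (Suc i)" "{..degree p}"]
    by (simp add: q_def pderiv_monom del: of_nat_Suc)
  then show ?thesis by (metis poly_as_sum_of_monoms)
qed

text \<open>Each integration stays among polynomials. Keeping this form, and not just smoothness, is
  what later allows an argument about growth at infinity.\<close>

lemma dist_deriv_eq_of_fun_poly:
  assumes "dist_deriv n T = of_fun (poly p)"
  obtains q where "T = of_fun (poly q)"
proof -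
  have "\<exists>q. T = of_fun (poly q)" using assms
  proof (induction n arbitrary: p)
    case (Suc n)
    obtain q where "pderiv q = p"
      using poly_antiderivative by blast
    then have q: "(poly q has_real_derivative poly p x) (at x)" for x
      using poly_DERIV by blast
    have "dist_deriv 1 (dist_deriv n T) = of_fun (poly p)"
      using Suc.prems dist_deriv_add[of 1 n T] by simp
    then obtain c where "dist_deriv n T = of_fun (\<lambda>x. poly q x + c)"
      using dist_deriv_eq_of_fun[OF _ continuous_on_smooth[OF smooth_poly] q] by blast
    also have "(\<lambda>x. poly q x + c) = poly (q + [:c:])" by auto
    finally show ?case by (rule Suc.IH)
  qed auto
  then show thesis using that by blast
qed

text \<open>At a point x of disagreement the sign \<open>s\<close> makes the difference
  \<open>k\<close> positive, and left continuity spreads this to an interval ending at x. A bump on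
  that interval then has a positive pairing with \<open>k\<close>, although \<open>k\<close> defines
  the zero distribution.\<close>

lemma of_fun_left_continuous_inject:
  assumes g: "locally_integrable g" "\<And>x. (g \<longlongrightarrow> g x) (at_left x)"
    and h: "locally_integrable h" "\<And>x. (h \<longlongrightarrow> h x) (at_left x)"
    and eq: "of_fun g = of_fun h"
  shows "g = h"
proof (rule ccontr)
  assume "g \<noteq> h"
  then obtain x where x: "g x \<noteq> h x" by auto
  define s where "s = sgn (g x - h x)"
  define k where "k = (\<lambda>y. s * g y + (- s) * h y)"
  have k: "locally_integrable k"
    unfolding k_def by (intro locally_integrable_lincomb g h)
  have "of_fun k = 0"
    unfolding k_def of_fun_lincomb[OF g(1) h(1)] eq by simp
  then have int0: "(LINT y|lebesgue. k y * apply_test \<phi> y) = 0" for \<phi>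
    using pairing_of_fun[OF k, of \<phi>] by (simp add: zero_distribution.rep_eq)
  have "(k \<longlongrightarrow> k x) (at_left x)"
    unfolding k_def by (intro tendsto_intros g h)
  moreover have "k x > 0"
    using x by (auto simp: k_def s_def sgn_if)
  ultimately have "\<forall>\<^sub>F y in at_left x. k y > 0"
    by (simp add: order_tendsto_iff)
  then obtain a where a: "a < x" "\<And>y. a < y \<Longrightarrow> y < x \<Longrightarrow> k y > 0"
    by (auto simp: eventually_at_left[of "x - 1" x])
  obtain \<rho> where \<rho>: "\<And>y. apply_test \<rho> y \<ge> 0" "\<And>y. apply_test \<rho> y > 0 \<longleftrightarrow> a < y \<and> y < x"
    using exists_bump[OF a(1)] by auto
  have "(LINT y|lebesgue. k y * apply_test \<rho> y) > 0"
  proof (rule integral_pos_of_interval[OF _ _ a(1)])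
    show "k y * apply_test \<rho> y \<ge> 0" for y
      using a(2)[of y] \<rho>[of y] by (cases "a < y \<and> y < x") auto
  qed (use a \<rho> integrable_mult_test[OF k] in auto)
  then show False using int0 by simp
qed


section \<open>Norms on subspaces\<close>

text \<open>Eliminates the locale \<open>Metric_space\<close> and the truncated distance
  \<open>norm_dist\<close>: in terms of \<open>N\<close> alone, completeness can be pulled back
  along an isometry.\<close>

lemma banach_on_iff:
  fixes S :: "'a::real_vector set"
  assumes S: "subspace S" and N: "norm_on S N"
  shows "banach_on S N \<longleftrightarrow>
    (\<forall>\<sigma> :: nat \<Rightarrow> 'a. range \<sigma> \<subseteq> S \<longrightarrow> (\<forall>e>0. \<exists>M. \<forall>i\<ge>M. \<forall>j\<ge>M. N (\<sigma> i - \<sigma> j) < e) \<longrightarrow>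
      (\<exists>x\<in>S. \<forall>e>0. \<exists>M. \<forall>i\<ge>M. N (\<sigma> i - x) < e))"
    (is "_ \<longleftrightarrow> (\<forall>\<sigma>. range \<sigma> \<subseteq> S \<longrightarrow> ?C \<sigma> \<longrightarrow> ?L \<sigma>)")
proof -
  interpret Metric_space S "norm_dist S N"
    using S N by (rule Metric_space_norm_dist)
  have lim: "(\<exists>x. limitin mtopology \<sigma> x sequentially) \<longleftrightarrow> ?L \<sigma>" if "range \<sigma> \<subseteq> S" for \<sigma>
    unfolding Bex_def using that
    by (intro iff_exI) (auto simp: limitin_metric eventually_sequentially norm_dist_def image_subset_iff)
  have "MCauchy \<sigma> \<longleftrightarrow> range \<sigma> \<subseteq> S \<and> ?C \<sigma>" for \<sigma>
    unfolding MCauchy_def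
    by (intro conj_cong refl) (simp add: norm_dist_def image_subset_iff imp_conjL)
  then have "banach_on S N \<longleftrightarrow> (\<forall>\<sigma>. range \<sigma> \<subseteq> S \<and> ?C \<sigma> \<longrightarrow> (\<exists>x. limitin mtopology \<sigma> x sequentially))"
    using S N by (simp add: banach_on_def mcomplete_def)
  also have "\<dots> \<longleftrightarrow> (\<forall>\<sigma>. range \<sigma> \<subseteq> S \<longrightarrow> ?C \<sigma> \<longrightarrow> ?L \<sigma>)"
    unfolding imp_conjL by (intro iff_allI imp_cong refl lim)
  finally show ?thesis .
qed

lemma topspace_norm_topology:
  assumes "subspace S" "norm_on S N"
  shows "topspace (norm_topology S N) = S"
  using Metric_space.topspace_mtopology[OF Metric_space_norm_dist[OF assms]]
  by (simp add: norm_topology_def)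

lemma norm_topology_closure_of:
  assumes S: "subspace S" and N: "norm_on S N" and "C \<subseteq> S"
  shows "norm_topology S N closure_of C = {x\<in>S. \<forall>r>0. \<exists>y\<in>C. N (x - y) < r}"
proof -
  interpret Metric_space S "norm_dist S N"
    using S N by (rule Metric_space_norm_dist)
  show ?thesis
    unfolding norm_topology_def metric_closure_of
    using \<open>C \<subseteq> S\<close> by (fastforce simp: norm_dist_def)
qed

lemma separable_norm_topology:
  assumes "subspace S" "norm_on S N"
  shows "separable_space (norm_topology S N) \<longleftrightarrow>
    (\<exists>C. countable C \<and> C \<subseteq> S \<and> (\<forall>x\<in>S. \<forall>r>0. \<exists>y\<in>C. N (x - y) < r))"
  unfolding separable_space_def topspace_norm_topology[OF assms]
  by (intro iff_exI conj_cong refl) (auto simp: norm_topology_closure_of[OF assms])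

text \<open>The natural isometry runs from functions to distributions, whereas the theorem states
  the opposite direction.\<close>

lemma isometrically_isomorphic_sym:
  assumes S: "subspace S" and iso: "isometrically_isomorphic S N S' N'"
  shows "isometrically_isomorphic S' N' S N"
proof -
  obtain \<Phi> where bij: "bij_betw \<Phi> S S'"
    and lin: "\<forall>a b. \<forall>x\<in>S. \<forall>y\<in>S. \<Phi> (a *\<^sub>R x + b *\<^sub>R y) = a *\<^sub>R \<Phi> x + b *\<^sub>R \<Phi> y"
    and norm: "\<forall>x\<in>S. N' (\<Phi> x) = N x"
    using iso unfolding isometrically_isomorphic_def by (elim exE conjE)
  define \<Psi> where "\<Psi> = inv_into S \<Phi>"
  have \<Psi>: "\<Psi> y \<in> S" "\<Phi> (\<Psi> y) = y" if "y \<in> S'" for y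
    using bij that by (auto simp: \<Psi>_def bij_betw_def inv_into_into f_inv_into_f)
  have \<Psi>_\<Phi>: "\<Psi> (\<Phi> x) = x" if "x \<in> S" for x
    using bij that by (simp add: \<Psi>_def bij_betw_def)
  show ?thesis
    unfolding isometrically_isomorphic_def
  proof (intro exI conjI allI ballI)
    show "bij_betw \<Psi> S' S"
      unfolding \<Psi>_def using bij by (rule bij_betw_inv_into)
    show "\<Psi> (a *\<^sub>R x + b *\<^sub>R y) = a *\<^sub>R \<Psi> x + b *\<^sub>R \<Psi> y" if "x \<in> S'" "y \<in> S'" for a b x y
    proof -
      have "a *\<^sub>R x + b *\<^sub>R y = \<Phi> (a *\<^sub>R \<Psi> x + b *\<^sub>R \<Psi> y)"
        using \<Psi> that by (simp add: lin)
      also have "\<Psi> \<dots> = a *\<^sub>R \<Psi> x + b *\<^sub>R \<Psi> y"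
        using \<Psi> that S by (intro \<Psi>_\<Phi>) (simp add: subspace_add subspace_scale)
      finally show ?thesis .
    qed
    show "N (\<Psi> y) = N' y" if "y \<in> S'" for y
      using norm \<Psi> that by metis
  qed
qed

section \<open>Transport of norm, completeness and separability along a linear isometry\<close>

context
  fixes S :: "'a::real_vector set" and N :: "'a \<Rightarrow> real" and \<Phi> :: "'a \<Rightarrow> 'b::real_vector"
    and N' :: "'b \<Rightarrow> real"
  assumes S: "subspace S"
    and lin: "\<And>a b x y. x \<in> S \<Longrightarrow> y \<in> S \<Longrightarrow> \<Phi> (a *\<^sub>R x + b *\<^sub>R y) = a *\<^sub>R \<Phi> x + b *\<^sub>R \<Phi> y"
begin

lemma image_linear_diff: "x \<in> S \<Longrightarrow> y \<in> S \<Longrightarrow> \<Phi> (x - y) = \<Phi> x - \<Phi> y"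
  using lin[of x y 1 "-1"] by simp

lemma image_linear_add: "x \<in> S \<Longrightarrow> y \<in> S \<Longrightarrow> \<Phi> (x + y) = \<Phi> x + \<Phi> y"
  using lin[of x y 1 1] by simp

lemma image_linear_scale: "x \<in> S \<Longrightarrow> \<Phi> (a *\<^sub>R x) = a *\<^sub>R \<Phi> x"
  using lin[of x x a 0] by simp

lemma subspace_image: "subspace (\<Phi> ` S)"
proof (rule subspaceI)
  have "\<Phi> 0 = 0" using lin[of 0 0 0 0] subspace_0[OF S] by simp
  then show "0 \<in> \<Phi> ` S" using subspace_0[OF S] by force
  show "x + y \<in> \<Phi> ` S" if "x \<in> \<Phi> ` S" "y \<in> \<Phi> ` S" for x y
    using that subspace_add[OF S] by (auto simp flip: image_linear_add)
  show "c *\<^sub>R x \<in> \<Phi> ` S" if "x \<in> \<Phi> ` S" for c x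
    using that subspace_scale[OF S] by (auto simp flip: image_linear_scale)
qed

context
  assumes norm: "\<And>x. x \<in> S \<Longrightarrow> N' (\<Phi> x) = N x" and N: "norm_on S N"
begin

lemma norm_on_image: "norm_on (\<Phi> ` S) N'"
proof -
  have zero: "\<Phi> 0 = 0" using lin[of 0 0 0 0] subspace_0[OF S] by simp
  have "N 0 = 0" using N subspace_0[OF S] by (simp add: norm_on_def)
  then have "N' 0 = 0" using norm[OF subspace_0[OF S]] zero by simp
  moreover have "0 \<le> N x" "N x = 0 \<longleftrightarrow> x = 0" if "x \<in> S" for x
    using N that by (auto simp: norm_on_def)
  ultimately have "0 \<le> N' y" "N' y = 0 \<longleftrightarrow> y = 0" if "y \<in> \<Phi> ` S" for y
    using that norm zero by auto
  moreover have "N' (c *\<^sub>R y) = \<bar>c\<bar> * N' y" if "y \<in> \<Phi> ` S" for c y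
    using that N norm subspace_scale[OF S]
    by (auto simp: norm_on_def simp flip: image_linear_scale)
  moreover have "N' (x + y) \<le> N' x + N' y" if "x \<in> \<Phi> ` S" "y \<in> \<Phi> ` S" for x y
    using that N norm subspace_add[OF S]
    by (auto simp: norm_on_def simp flip: image_linear_add)
  ultimately show ?thesis
    unfolding norm_on_def by blast
qed

lemma norm_image_diff: "x \<in> S \<Longrightarrow> y \<in> S \<Longrightarrow> N' (\<Phi> x - \<Phi> y) = N (x - y)"
  using norm[OF subspace_diff[OF S]] image_linear_diff by simp

lemma banach_on_image:
  assumes "banach_on S N"
  shows "banach_on (\<Phi> ` S) N'"
  unfolding banach_on_iff[OF subspace_image norm_on_image]
proof (intro allI impI)
  fix \<tau> :: "nat \<Rightarrow> 'b"
  assume \<tau>: "range \<tau> \<subseteq> \<Phi> ` S" and cauchy: "\<forall>e>0. \<exists>M. \<forall>i\<ge>M. \<forall>j\<ge>M. N' (\<tau> i - \<tau> j) < e"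
  have "\<forall>i. \<exists>x\<in>S. \<tau> i = \<Phi> x"
    using \<tau> by blast
  then obtain \<sigma> where \<sigma>: "\<And>i. \<sigma> i \<in> S" "\<And>i. \<tau> i = \<Phi> (\<sigma> i)"
    by metis
  have "range \<sigma> \<subseteq> S" "\<forall>e>0. \<exists>M. \<forall>i\<ge>M. \<forall>j\<ge>M. N (\<sigma> i - \<sigma> j) < e"
    using \<sigma> cauchy by (auto simp: norm_image_diff)
  then obtain x where x: "x \<in> S" "\<forall>e>0. \<exists>M. \<forall>i\<ge>M. N (\<sigma> i - x) < e"
    using assms unfolding banach_on_iff[OF S N] by blast
  then show "\<exists>y\<in>\<Phi> ` S. \<forall>e>0. \<exists>M. \<forall>i\<ge>M. N' (\<tau> i - y) < e"
    using \<sigma> by (intro bexI[of _ "\<Phi> x"]) (auto simp: norm_image_diff)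
qed

text \<open>Both implications are used: one makes \<open>A_c n\<close> separable, the other lets
  \<open>A_r n\<close> inherit nonseparability.\<close>

lemma separable_norm_topology_image:
  "separable_space (norm_topology (\<Phi> ` S) N') \<longleftrightarrow> separable_space (norm_topology S N)"
  unfolding separable_norm_topology[OF S N] separable_norm_topology[OF subspace_image norm_on_image]
proof
  assume "\<exists>C. countable C \<and> C \<subseteq> S \<and> (\<forall>x\<in>S. \<forall>r>0. \<exists>y\<in>C. N (x - y) < r)"
  then obtain C where C: "countable C" "C \<subseteq> S" "\<forall>x\<in>S. \<forall>r>0. \<exists>y\<in>C. N (x - y) < r"
    by blast
  have "\<exists>y\<in>\<Phi> ` C. N' (\<Phi> x - y) < r" if xr: "x \<in> S" "r > 0" for x r
  proof -
    obtain y where "y \<in> C" "N (x - y) < r" using C(3) xr by blast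
    then show ?thesis using C(2) xr by (intro bexI[of _ "\<Phi> y"]) (auto simp: norm_image_diff)
  qed
  then show "\<exists>C. countable C \<and> C \<subseteq> \<Phi> ` S \<and> (\<forall>x\<in>\<Phi> ` S. \<forall>r>0. \<exists>y\<in>C. N' (x - y) < r)"
    using C(1,2) by (intro exI[of _ "\<Phi> ` C"]) auto
next
  assume "\<exists>C. countable C \<and> C \<subseteq> \<Phi> ` S \<and> (\<forall>x\<in>\<Phi> ` S. \<forall>r>0. \<exists>y\<in>C. N' (x - y) < r)"
  then obtain C where C: "countable C" "C \<subseteq> \<Phi> ` S" "\<forall>x\<in>\<Phi> ` S. \<forall>r>0. \<exists>y\<in>C. N' (x - y) < r"
    by blast
  define \<Psi> where "\<Psi> = inv_into S \<Phi>"
  have \<Psi>: "\<Psi> y \<in> S" "\<Phi> (\<Psi> y) = y" if "y \<in> C" for y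
    using C(2) that by (auto simp: \<Psi>_def inv_into_into f_inv_into_f subset_iff)
  have "\<exists>y\<in>\<Psi> ` C. N (x - y) < r" if xr: "x \<in> S" "r > 0" for x r
  proof -
    obtain y where "y \<in> C" "N' (\<Phi> x - y) < r" using C(3) xr by blast
    then show ?thesis
      using xr \<Psi>[of y] norm_image_diff[of x "\<Psi> y"] by (intro bexI[of _ "\<Psi> y"]) auto
  qed
  then show "\<exists>C. countable C \<and> C \<subseteq> S \<and> (\<forall>x\<in>S. \<forall>r>0. \<exists>y\<in>C. N (x - y) < r)"
    using C(1) \<Psi> by (intro exI[of _ "\<Psi> ` C"]) auto
qed

end

end


section \<open>Regulated functions\<close>

lemma at_MInf: "at (- \<infinity> :: ereal) = filtermap ereal at_bot"
proof -
  have "{..< - \<infinity> :: ereal} = {}"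
    using not_MInfty_nonneg by (auto simp: lessThan_def)
  then have "at_left (- \<infinity> :: ereal) = bot"
    by (simp only: at_within_empty)
  then show ?thesis
    using at_eq_sup_left_right[of "- \<infinity> :: ereal"] at_right_MInf by (metis sup_bot_left)
qed
lemma isCont_ereal_iff:
  fixes F :: "ereal \<Rightarrow> real"
  shows "isCont F (ereal x) \<longleftrightarrow> isCont (F \<circ> ereal) x"
    and "isCont F \<infinity> \<longleftrightarrow> ((F \<circ> ereal) \<longlongrightarrow> F \<infinity>) at_top"
    and "isCont F (- \<infinity>) \<longleftrightarrow> ((F \<circ> ereal) \<longlongrightarrow> F (- \<infinity>)) at_bot"
  unfolding isCont_def unfolding at_ereal at_infty_ereal_eq_at_top at_MInf tendsto_compose_filtermap
  by simp_all

text \<open>Reconciles \<open>B_c\<close>, given by continuity on the compact space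
  \<open>ereal\<close>, with \<open>B_r\<close>, given by limits along the real line.\<close>

lemma continuous_on_ereal_iff:
  fixes F :: "ereal \<Rightarrow> real"
  shows "continuous_on UNIV F \<longleftrightarrow> continuous_on UNIV (F \<circ> ereal) \<and>
    ((F \<circ> ereal) \<longlongrightarrow> F \<infinity>) at_top \<and> ((F \<circ> ereal) \<longlongrightarrow> F (- \<infinity>)) at_bot"
proof -
  have "continuous_on UNIV F \<longleftrightarrow> (\<forall>x. isCont F (ereal x)) \<and> isCont F \<infinity> \<and> isCont F (- \<infinity>)"
    unfolding continuous_on_eq_continuous_at[OF open_UNIV] by (auto simp: ereal_all_split)
  then show ?thesis
    unfolding isCont_ereal_iff continuous_on_eq_continuous_at[OF open_UNIV] by simp
qed

lemma B_r_iff: "F \<in> B_r \<longleftrightarrow>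
    F (- \<infinity>) = 0 \<and> ((F \<circ> ereal) \<longlongrightarrow> F \<infinity>) at_top \<and> ((F \<circ> ereal) \<longlongrightarrow> 0) at_bot \<and>
    (\<forall>x. ((F \<circ> ereal) \<longlongrightarrow> F (ereal x)) (at_left x)) \<and> (\<forall>x. \<exists>l. ((F \<circ> ereal) \<longlongrightarrow> l) (at_right x))"
  unfolding B_r_def regulated_def by auto

lemma B_r_right_limit: "F \<in> B_r \<Longrightarrow> \<exists>l. ((F \<circ> ereal) \<longlongrightarrow> l) (at_right x)"
  by (simp add: B_r_iff)

lemma B_c_iff: "F \<in> B_c \<longleftrightarrow> F \<in> B_r \<and> continuous_on UNIV (F \<circ> ereal)"
proof
  assume F: "F \<in> B_c"
  then have cont: "continuous_on UNIV (F \<circ> ereal)"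
    by (simp add: B_c_def continuous_on_ereal_iff)
  then have "((F \<circ> ereal) \<longlongrightarrow> F (ereal x)) (at x)" for x
    by (simp add: continuous_on_def o_def)
  then have "((F \<circ> ereal) \<longlongrightarrow> F (ereal x)) (at_left x)" "((F \<circ> ereal) \<longlongrightarrow> F (ereal x)) (at_right x)" for x
    by (simp_all only: filterlim_at_split)
  then show "F \<in> B_r \<and> continuous_on UNIV (F \<circ> ereal)"
    using F cont unfolding B_r_iff B_c_def continuous_on_ereal_iff by auto
qed (auto simp: B_c_def B_r_iff continuous_on_ereal_iff)

lemma B_c_subset_B_r: "B_c \<subseteq> B_r"
  by (auto simp: B_c_iff)

lemma B_c_imp_B_r: "F \<in> B_c \<Longrightarrow> F \<in> B_r"
  using B_c_subset_B_r by blast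

lemma subspace_B_r: "subspace B_r"
proof (rule subspaceI)
  show "0 \<in> B_r" by (auto simp: B_r_iff o_def)
  show "F + G \<in> B_r" if FG: "F \<in> B_r" "G \<in> B_r" for F G
  proof -
    have "\<exists>l. (((F + G) \<circ> ereal) \<longlongrightarrow> l) (at_right x)" for x
    proof -
      obtain l m where "((F \<circ> ereal) \<longlongrightarrow> l) (at_right x)" "((G \<circ> ereal) \<longlongrightarrow> m) (at_right x)"
        using FG[THEN B_r_right_limit] by metis
      then have "((\<lambda>x. F (ereal x) + G (ereal x)) \<longlongrightarrow> l + m) (at_right x)"
        unfolding o_def by (rule tendsto_add)
      then show ?thesis by (auto simp: o_def)
    qed
    then show ?thesis
      using FG by (auto simp: B_r_iff o_def intro!: tendsto_add tendsto_add_zero)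
  qed
  show "c *\<^sub>R F \<in> B_r" if F: "F \<in> B_r" for c F
  proof -
    have "\<exists>l. ((c *\<^sub>R F \<circ> ereal) \<longlongrightarrow> l) (at_right x)" for x
    proof -
      obtain l where "((F \<circ> ereal) \<longlongrightarrow> l) (at_right x)"
        using B_r_right_limit[OF F] by blast
      then have "((\<lambda>x. c * F (ereal x)) \<longlongrightarrow> c * l) (at_right x)"
        unfolding o_def by (rule tendsto_mult_left)
      then show ?thesis by (auto simp: o_def)
    qed
    then show ?thesis
      using F by (auto simp: B_r_iff o_def intro!: tendsto_mult_left tendsto_mult_right_zero)
  qed
qed

lemma subspace_B_c: "subspace B_c"
proof -
  have eq: "B_c = B_r \<inter> {F. continuous_on UNIV (F \<circ> ereal)}"
    by (auto simp: B_c_iff)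
  have "subspace {F :: ereal \<Rightarrow> real. continuous_on UNIV (F \<circ> ereal)}"
    by (rule subspaceI) (auto simp: o_def intro!: continuous_intros)
  then show ?thesis
    unfolding eq by (rule subspace_inter[OF subspace_B_r])
qed

section \<open>Boundedness and the supremum norm\<close>

text \<open>The one-sided limits, and the limits at both infinities, bound \<open>F\<close> near
  each point of \<open>ereal\<close>; by compactness finitely many of these neighbourhoods
  suffice.\<close>

lemma B_r_bounded:
  assumes "F \<in> B_r"
  obtains M where "\<And>x. \<bar>F x\<bar> \<le> M"
proof -
  have lim: "\<exists>M. \<forall>\<^sub>F y in G. \<bar>F (ereal y)\<bar> \<le> M" if "((F \<circ> ereal) \<longlongrightarrow> l) G" for l G
  proof -
    have "\<forall>\<^sub>F y in G. dist ((F \<circ> ereal) y) l < 1"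
      using that by (rule tendstoD) simp
    then have "\<forall>\<^sub>F y in G. \<bar>F (ereal y)\<bar> \<le> \<bar>l\<bar> + 1"
      by eventually_elim (auto simp: dist_real_def)
    then show ?thesis by blast
  qed
  have "\<exists>M. \<forall>\<^sub>F y in at x. \<bar>F y\<bar> \<le> M" for x
  proof (cases x)
    case (real r)
    obtain l where "((F \<circ> ereal) \<longlongrightarrow> l) (at_right r)"
      using B_r_right_limit[OF assms] by blast
    moreover have "((F \<circ> ereal) \<longlongrightarrow> F (ereal r)) (at_left r)"
      using assms by (simp add: B_r_iff)
    ultimately obtain M M' where "\<forall>\<^sub>F y in at_right r. \<bar>F (ereal y)\<bar> \<le> M"
        "\<forall>\<^sub>F y in at_left r. \<bar>F (ereal y)\<bar> \<le> M'"
      using lim by meson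
    then have "\<forall>\<^sub>F y in at_right r. \<bar>F (ereal y)\<bar> \<le> max M M'"
        "\<forall>\<^sub>F y in at_left r. \<bar>F (ereal y)\<bar> \<le> max M M'"
      by (auto elim!: eventually_mono)
    then show ?thesis
      unfolding real at_ereal eventually_filtermap eventually_at_split by blast
  qed (use assms lim in \<open>auto simp: B_r_iff at_infty_ereal_eq_at_top at_MInf eventually_filtermap\<close>)
  then have "\<exists>M. \<forall>\<^sub>F y in nhds x. \<bar>F y\<bar> \<le> M" for x
  proof -
    obtain M where "\<forall>\<^sub>F y in at x. \<bar>F y\<bar> \<le> M"
      using \<open>\<And>x. \<exists>M. \<forall>\<^sub>F y in at x. \<bar>F y\<bar> \<le> M\<close> by blast
    then have "\<forall>\<^sub>F y in nhds x. \<bar>F y\<bar> \<le> max M \<bar>F x\<bar>"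
      unfolding eventually_at_filter by (auto elim!: eventually_mono)
    then show ?thesis by blast
  qed
  then obtain M where "\<And>x. \<forall>\<^sub>F y in nhds x. \<bar>F y\<bar> \<le> M x" by metis
  then obtain U where U: "\<And>x. open (U x)" "\<And>x. x \<in> U x" "\<And>x y. y \<in> U x \<Longrightarrow> \<bar>F y\<bar> \<le> M x"
    unfolding eventually_nhds by metis
  obtain D where D: "finite D" "(UNIV :: ereal set) \<subseteq> (\<Union>x\<in>D. U x)"
    by (rule compactE_image[OF compact_UNIV, of UNIV U]) (use U in auto)
  show thesis
  proof (rule that)
    fix y
    obtain x where "x \<in> D" "y \<in> U x" using D by blast
    then have "\<bar>F y\<bar> \<le> M x" "M x \<le> Max (M ` D)"
      using U D by auto
    then show "\<bar>F y\<bar> \<le> Max (M ` D)" by simp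
  qed
qed

text \<open>\<open>B_norm\<close> is a supremum over real points only. The bound passes to
  \<infinity> as a limit, and at -\<infinity> the value is 0.\<close>

lemma abs_le_B_norm:
  assumes F: "F \<in> B_r"
  shows "\<bar>F x\<bar> \<le> B_norm F"
proof -
  obtain M where "\<And>x. \<bar>F x\<bar> \<le> M" using B_r_bounded[OF F] by blast
  then have real: "\<bar>F (ereal y)\<bar> \<le> B_norm F" for y
    unfolding B_norm_def sup_norm_def by (auto intro!: cSUP_upper2[of _ _ y] bdd_aboveI2)
  show ?thesis
  proof (cases x)
    case PInf
    have "((\<lambda>x. \<bar>F (ereal x)\<bar>) \<longlongrightarrow> \<bar>F \<infinity>\<bar>) at_top"
      using F unfolding B_r_iff o_def by (intro tendsto_rabs) auto
    then show ?thesis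
      unfolding PInf using real by (intro tendsto_upperbound[of _ _ at_top]) auto
  next
    case MInf
    then show ?thesis
      using F abs_ge_zero[of "F (ereal 0)"] real[of 0] by (simp add: B_r_iff del: abs_ge_zero)
  qed (use real in simp)
qed

lemma B_norm_le: "(\<And>x. \<bar>F (ereal x)\<bar> \<le> M) \<Longrightarrow> B_norm F \<le> M"
  unfolding B_norm_def sup_norm_def by (auto intro: cSUP_least)

lemma norm_on_B_r: "norm_on B_r B_norm"
  unfolding norm_on_def
proof (intro conjI ballI allI)
  fix F assume F: "F \<in> B_r"
  note le = abs_le_B_norm[OF F]
  show nonneg: "0 \<le> B_norm F"
    using le[of 0] by linarith
  show "B_norm F = 0 \<longleftrightarrow> F = 0"
  proof
    assume "B_norm F = 0"
    then show "F = 0" using le by (auto simp: fun_eq_iff)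
  next
    assume "F = 0"
    then have "B_norm F \<le> 0" by (intro B_norm_le) simp
    then show "B_norm F = 0" using nonneg by simp
  qed
  show "B_norm (F + G) \<le> B_norm F + B_norm G" if G: "G \<in> B_r" for G
  proof (rule B_norm_le)
    show "\<bar>(F + G) (ereal x)\<bar> \<le> B_norm F + B_norm G" for x
      using le[of x] abs_le_B_norm[OF G, of x] by simp
  qed
  show "B_norm (c *\<^sub>R F) = \<bar>c\<bar> * B_norm F" for c
  proof (rule antisym)
    show "B_norm (c *\<^sub>R F) \<le> \<bar>c\<bar> * B_norm F"
      using le by (intro B_norm_le) (simp add: abs_mult mult_left_mono)
    show "\<bar>c\<bar> * B_norm F \<le> B_norm (c *\<^sub>R F)"
    proof (cases "c = 0")
      case True
      then show ?thesis
        using abs_le_B_norm[OF subspace_0[OF subspace_B_r], of 0] by simp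
    next
      case False
      have "\<bar>F (ereal x)\<bar> \<le> B_norm (c *\<^sub>R F) / \<bar>c\<bar>" for x
        using False abs_le_B_norm[OF subspace_scale[OF subspace_B_r F], of c x]
        by (simp add: abs_mult field_simps)
      then have "B_norm F \<le> B_norm (c *\<^sub>R F) / \<bar>c\<bar>"
        by (rule B_norm_le)
      then show ?thesis using False by (simp add: field_simps)
    qed
  qed
qed

lemma norm_on_subset: "norm_on S N \<Longrightarrow> T \<subseteq> S \<Longrightarrow> norm_on T N"
  by (simp add: norm_on_def subset_iff)

lemma norm_on_B_c: "norm_on B_c B_norm"
  using norm_on_B_r B_c_subset_B_r by (rule norm_on_subset)

section \<open>Completeness through uniform limits\<close>

text \<open>The Moore-Osgood exchange of limits. It also produces the limit \<open>m\<close>, as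
  right limits of a uniform limit are not known in advance to exist.\<close>

lemma uniform_limit_exchange:
  fixes \<sigma> :: "nat \<Rightarrow> 'a \<Rightarrow> real"
  assumes unif: "uniform_limit UNIV \<sigma> g sequentially" and "G \<noteq> bot"
    and lim: "\<And>i. (\<sigma> i \<longlongrightarrow> l i) G"
  obtains m where "(g \<longlongrightarrow> m) G" "l \<longlonglongrightarrow> m"
proof -
  have "Cauchy l"
  proof (rule metric_CauchyI)
    fix e :: real assume "e > 0"
    \<comment> \<open>Two quarters bound the distance of two members by e / 2; the passage to the
      limit along \<open>G\<close> keeps only a weak inequality, which still stays below e.\<close>
    then have "\<forall>\<^sub>F i in sequentially. \<forall>y\<in>UNIV. dist (\<sigma> i y) (g y) < e / 4"
      by (intro uniform_limitD[OF unif]) simp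
    then obtain M where M: "\<And>i y. i \<ge> M \<Longrightarrow> dist (\<sigma> i y) (g y) < e / 4"
      unfolding eventually_sequentially by blast
    have "dist (l i) (l j) < e" if "i \<ge> M" "j \<ge> M" for i j
    proof -
      have "dist (\<sigma> i y) (\<sigma> j y) \<le> e / 2" for y
        using M[OF \<open>i \<ge> M\<close>, of y] M[OF \<open>j \<ge> M\<close>, of y]
          dist_triangle2[of "\<sigma> i y" "\<sigma> j y" "g y"] by linarith
      moreover have "((\<lambda>y. dist (\<sigma> i y) (\<sigma> j y)) \<longlongrightarrow> dist (l i) (l j)) G"
        by (intro tendsto_dist lim)
      ultimately have "dist (l i) (l j) \<le> e / 2"
        using \<open>G \<noteq> bot\<close> by (intro tendsto_upperbound) auto
      then show ?thesis using \<open>e > 0\<close> by simp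
    qed
    then show "\<exists>M. \<forall>m\<ge>M. \<forall>n\<ge>M. dist (l m) (l n) < e" by blast
  qed
  then obtain m where m: "l \<longlonglongrightarrow> m"
    using Cauchy_convergent_iff convergent_def by blast
  moreover have "(g \<longlongrightarrow> m) G"
    by (rule swap_uniform_limit'[OF always_eventually[OF allI[OF lim]] m unif]) auto
  ultimately show thesis using that by blast
qed

lemma B_r_uniform_limit:
  assumes unif: "uniform_limit UNIV \<sigma> F sequentially" and \<sigma>: "\<And>i. \<sigma> i \<in> B_r"
  shows "F \<in> B_r"
proof -
  have unif': "uniform_limit UNIV (\<lambda>i. \<sigma> i \<circ> ereal) (F \<circ> ereal) sequentially"
    unfolding o_def by (rule uniform_limit_compose'[OF unif]) simp
  have pt: "(\<lambda>i. \<sigma> i x) \<longlonglongrightarrow> F x" for x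
    using tendsto_uniform_limitI[OF unif] by simp
  \<comment> \<open>Left limits and the limits at both infinities have a prescribed value,
    identified by pointwise convergence. Right limits, treated in \<open>ex\<close>, only have to
    exist.\<close>
  have lim: "((F \<circ> ereal) \<longlongrightarrow> F x) G" if G: "G \<noteq> bot" "\<And>i. ((\<sigma> i \<circ> ereal) \<longlongrightarrow> \<sigma> i x) G" for x G
  proof -
    obtain m where "((F \<circ> ereal) \<longlongrightarrow> m) G" "(\<lambda>i. \<sigma> i x) \<longlonglongrightarrow> m"
      using uniform_limit_exchange[OF unif' G] by blast
    then show ?thesis using LIMSEQ_unique[OF _ pt[of x]] by blast
  qed
  have ex: "\<exists>l. ((F \<circ> ereal) \<longlongrightarrow> l) (at_right x)" for x
  proof -
    have "\<exists>l. \<forall>i. ((\<sigma> i \<circ> ereal) \<longlongrightarrow> l i) (at_right x)"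
      by (rule choice) (use B_r_right_limit[OF \<sigma>] in blast)
    then obtain l where "\<And>i. ((\<sigma> i \<circ> ereal) \<longlongrightarrow> l i) (at_right x)"
      by blast
    then obtain m where "((F \<circ> ereal) \<longlongrightarrow> m) (at_right x)"
      by (rule uniform_limit_exchange[OF unif' trivial_limit_at_right_real])
    then show ?thesis by blast
  qed
  have "F (- \<infinity>) = 0"
    using pt[of "- \<infinity>"] \<sigma> by (simp add: B_r_iff LIMSEQ_const_iff)
  moreover have "((F \<circ> ereal) \<longlongrightarrow> F (- \<infinity>)) at_bot" "((F \<circ> ereal) \<longlongrightarrow> F \<infinity>) at_top"
    using \<sigma> by (auto intro!: lim simp: B_r_iff)
  moreover have "((F \<circ> ereal) \<longlongrightarrow> F (ereal x)) (at_left x)" for x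
    using \<sigma> by (auto intro!: lim simp: B_r_iff)
  ultimately show ?thesis using ex by (simp add: B_r_iff)
qed

lemma B_c_uniform_limit:
  assumes unif: "uniform_limit UNIV \<sigma> F sequentially" and \<sigma>: "\<And>i. \<sigma> i \<in> B_c"
  shows "F \<in> B_c"
proof -
  have "F \<in> B_r"
    using unif B_c_subset_B_r \<sigma> by (intro B_r_uniform_limit[OF unif]) auto
  moreover have "continuous_on UNIV F"
    by (rule uniform_limit_theorem[OF _ unif]) (use \<sigma> in \<open>auto simp: B_c_def\<close>)
  ultimately show ?thesis
    by (simp add: B_c_def B_r_iff)
qed

text \<open>A Cauchy sequence for \<open>B_norm\<close> is uniformly Cauchy on all of
  \<open>ereal\<close>, so completeness of \<open>B_r\<close> and of \<open>B_c\<close> differs only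
  in the closedness under uniform limits.\<close>

lemma banach_on_uniformly_closed:
  assumes S: "subspace S" "S \<subseteq> B_r"
    and closed: "\<And>\<sigma> F. uniform_limit UNIV \<sigma> F sequentially \<Longrightarrow> range \<sigma> \<subseteq> S \<Longrightarrow> F \<in> S"
  shows "banach_on S B_norm"
  unfolding banach_on_iff[OF S(1) norm_on_subset[OF norm_on_B_r S(2)]]
proof (intro allI impI)
  fix \<sigma> :: "nat \<Rightarrow> ereal \<Rightarrow> real"
  assume \<sigma>: "range \<sigma> \<subseteq> S" and cauchy: "\<forall>e>0. \<exists>M. \<forall>i\<ge>M. \<forall>j\<ge>M. B_norm (\<sigma> i - \<sigma> j) < e"
  have "\<sigma> i - \<sigma> j \<in> B_r" for i j
    using \<sigma> S(2) subspace_diff[OF S(1), of "\<sigma> i" "\<sigma> j"] by blast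
  then have le: "dist (\<sigma> i x) (\<sigma> j x) \<le> B_norm (\<sigma> i - \<sigma> j)" for i j x
    using abs_le_B_norm[of "\<sigma> i - \<sigma> j" x] by (simp add: dist_real_def)
  have "uniformly_convergent_on UNIV \<sigma>"
  proof (rule Cauchy_uniformly_convergent, rule uniformly_Cauchy_onI)
    fix e :: real assume "e > 0"
    then obtain M where "\<forall>i\<ge>M. \<forall>j\<ge>M. B_norm (\<sigma> i - \<sigma> j) < e" using cauchy by blast
    then show "\<exists>M. \<forall>x\<in>UNIV. \<forall>i\<ge>M. \<forall>j\<ge>M. dist (\<sigma> i x) (\<sigma> j x) < e"
      using le by (meson le_less_trans)
  qed
  then obtain F where unif: "uniform_limit UNIV \<sigma> F sequentially"
    by (auto simp: uniformly_convergent_on_def)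
  have "\<exists>M. \<forall>i\<ge>M. B_norm (\<sigma> i - F) < e" if "e > 0" for e
  proof -
    obtain M where M: "\<And>i x. i \<ge> M \<Longrightarrow> dist (\<sigma> i x) (F x) < e / 2"
      using uniform_limitD[OF unif, of "e / 2"] \<open>e > 0\<close> by (auto simp: eventually_sequentially)
    have "B_norm (\<sigma> i - F) \<le> e / 2" if "i \<ge> M" for i
      using M[OF that] by (intro B_norm_le) (simp add: dist_real_def less_imp_le)
    then show ?thesis using \<open>e > 0\<close> by (intro exI[of _ M]) force
  qed
  then show "\<exists>F\<in>S. \<forall>e>0. \<exists>M. \<forall>i\<ge>M. B_norm (\<sigma> i - F) < e"
    using closed[OF unif \<sigma>] by blast
qed

lemma banach_on_B_r: "banach_on B_r B_norm"
  by (rule banach_on_uniformly_closed[OF subspace_B_r]) (auto intro: B_r_uniform_limit)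

lemma banach_on_B_c: "banach_on B_c B_norm"
  by (rule banach_on_uniformly_closed[OF subspace_B_c B_c_subset_B_r]) (auto intro: B_c_uniform_limit)

section \<open>Measurability and translation of regulated functions\<close>

lemma left_continuous_borel_measurable:
  fixes g :: "real \<Rightarrow> real"
  assumes "\<And>x. (g \<longlongrightarrow> g x) (at_left x)"
  shows "g \<in> borel_measurable borel"
proof (rule borel_measurable_LIMSEQ_real)
  \<comment> \<open>\<open>p k x\<close> is the largest multiple of \<open>1 / (k + 1)\<close> strictly below \<open>x\<close>, so it tends to \<open>x\<close> from the left.\<close>
  define p where "p = (\<lambda>k x. (of_int (\<lceil>real (Suc k) * x\<rceil> - 1) :: real) / real (Suc k))"
  show "(\<lambda>x. g (p k x)) \<in> borel_measurable borel" for k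
  proof -
    have scale: "(\<lambda>x. real (Suc k) * x) \<in> borel_measurable borel"
      by (intro borel_measurable_continuous_onI continuous_intros)
    \<comment> \<open>After the ceiling, \<open>g\<close> is sampled only at countably many grid
      points, and every function on a discrete space is measurable.\<close>
    have grid: "(\<lambda>i::int. g (of_int (i - 1) / real (Suc k))) \<in> measurable (count_space UNIV) borel"
      unfolding measurable_count_space_eq1 by simp
    show ?thesis
      unfolding p_def
      by (rule measurable_compose[OF measurable_compose[OF scale measurable_real_ceiling] grid])
  qed
  fix x :: real
  have p: "p k x < x" "x - 1 / real (Suc k) \<le> p k x" for k
  proof -
    have "real (Suc k) * x - 1 \<le> of_int (\<lceil>real (Suc k) * x\<rceil> - 1)"
      "of_int (\<lceil>real (Suc k) * x\<rceil> - 1) < real (Suc k) * x"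
      by linarith+
    moreover have "x - 1 / real (Suc k) = (real (Suc k) * x - 1) / real (Suc k)"
      by (simp add: diff_divide_distrib del: of_nat_Suc)
    ultimately show "p k x < x" "x - 1 / real (Suc k) \<le> p k x"
      by (auto simp: p_def pos_divide_less_eq mult.commute divide_right_mono
          simp del: of_int_diff of_nat_Suc)
  qed
  have "(\<lambda>k. x - 1 / real (Suc k)) \<longlonglongrightarrow> x - 0"
    by (intro tendsto_diff tendsto_const LIMSEQ_Suc lim_1_over_n)
  then have "(\<lambda>k. p k x) \<longlonglongrightarrow> x"
    by (intro tendsto_sandwich[of "\<lambda>k. x - 1 / real (Suc k)" "\<lambda>k. p k x" _ "\<lambda>k. x"])
      (use p in \<open>auto simp: less_imp_le\<close>)
  then have "filterlim (\<lambda>k. p k x) (at_left x) sequentially"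
    unfolding filterlim_at using p(1) by (auto simp: order_less_imp_not_eq)
  then show "(\<lambda>k. g (p k x)) \<longlonglongrightarrow> g x"
    by (rule filterlim_compose[OF assms])
qed

lemma B_r_measurable: "F \<in> B_r \<Longrightarrow> F \<circ> ereal \<in> borel_measurable borel"
  by (rule left_continuous_borel_measurable) (simp add: B_r_iff)

lemma B_r_locally_integrable:
  assumes "F \<in> B_r"
  shows "locally_integrable (F \<circ> ereal)"
proof (rule locally_integrable_bounded[OF B_r_measurable[OF assms]])
  show "bounded ((F \<circ> ereal) ` K)" for K
    using abs_le_B_norm[OF assms] by (auto simp: bounded_iff)
qed

lemma B_r_translate:
  assumes "F \<in> B_r"
  shows "(\<lambda>x. F (x - ereal t)) \<in> B_r"
proof -
  have eq: "(\<lambda>x. F (x - ereal t)) \<circ> ereal = (\<lambda>x. (F \<circ> ereal) (x - t))"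
    by (simp add: o_def)
  have left: "filterlim (\<lambda>y. y - t) (at_left (x - t)) (at_left x)" for x :: real
    by (simp add: filterlim_def filtermap_at_left_shift)
  have right: "filterlim (\<lambda>y. y - t) (at_right (x - t)) (at_right x)" for x :: real
    by (simp add: filterlim_def filtermap_at_right_shift)
  have top: "filterlim (\<lambda>y. y - t) at_top at_top"
    unfolding filterlim_at_top eventually_at_top_linorder by (metis le_diff_eq)
  have bot: "filterlim (\<lambda>y. y - t) at_bot at_bot"
    unfolding filterlim_at_bot eventually_at_bot_linorder by (metis diff_le_eq)
  have "\<exists>l. ((\<lambda>x. (F \<circ> ereal) (x - t)) \<longlongrightarrow> l) (at_right x)" for x
    using assms filterlim_compose[OF _ right] unfolding B_r_iff by blast
  moreover have "((\<lambda>x. (F \<circ> ereal) (x - t)) \<longlongrightarrow> F (ereal (x - t))) (at_left x)" for x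
    using assms unfolding B_r_iff by (intro filterlim_compose[OF _ left]) blast
  moreover have "((\<lambda>x. (F \<circ> ereal) (x - t)) \<longlongrightarrow> F \<infinity>) at_top"
    using assms unfolding B_r_iff by (intro filterlim_compose[OF _ top]) blast
  moreover have "((\<lambda>x. (F \<circ> ereal) (x - t)) \<longlongrightarrow> 0) at_bot"
    using assms unfolding B_r_iff by (intro filterlim_compose[OF _ bot]) blast
  ultimately show ?thesis
    using assms unfolding B_r_iff eq by simp
qed

lemma B_c_translate:
  assumes "F \<in> B_c"
  shows "(\<lambda>x. F (x - ereal t)) \<in> B_c"
proof -
  have cont: "continuous_on UNIV (F \<circ> ereal)" and F: "F \<in> B_r"
    using assms by (simp_all add: B_c_iff)
  have "continuous_on UNIV (\<lambda>x. (F \<circ> ereal) (x - t))"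
    by (rule continuous_on_compose2[OF cont]) (simp_all add: continuous_on_diff)
  then show ?thesis
    unfolding B_c_iff using B_r_translate[OF F] by (simp add: o_def)
qed

lemma B_norm_translate: "B_norm (\<lambda>x. F (x - ereal t)) = B_norm F"
proof -
  have "range (\<lambda>x. \<bar>F (ereal x)\<bar>) = range (\<lambda>x. \<bar>F (ereal (x - t))\<bar>)"
    by (auto simp: image_iff intro!: exI[of _ "_ + t"] )
  then show ?thesis
    by (simp add: B_norm_def sup_norm_def)
qed

section \<open>Step functions and nonseparability\<close>

text \<open>The strict inequality makes the jump left continuous, as \<open>B_r\<close>
  demands.\<close>

definition step :: "real \<Rightarrow> ereal \<Rightarrow> real" where
  "step a x = (if x > ereal a then 1 else 0)"

lemma step_in_B_r: "step a \<in> B_r"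
proof -
  have "((step a \<circ> ereal) \<longlongrightarrow> 1) at_top"
    by (intro tendsto_eventually eventually_mono[OF eventually_gt_at_top[of a]]) (simp add: step_def)
  moreover have "((step a \<circ> ereal) \<longlongrightarrow> 0) at_bot"
    by (intro tendsto_eventually eventually_mono[OF eventually_le_at_bot[of a]]) (simp add: step_def)
  moreover have "((step a \<circ> ereal) \<longlongrightarrow> step a (ereal x)) (at_left x)" for x
  proof (rule tendsto_eventually)
    show "\<forall>\<^sub>F y in at_left x. (step a \<circ> ereal) y = step a (ereal x)"
      unfolding eventually_at_left_field
      by (cases "x > a") (auto simp: step_def intro!: exI[of _ "if x > a then a else x - 1"])
  qed
  moreover have "\<exists>l. ((step a \<circ> ereal) \<longlongrightarrow> l) (at_right x)" for x
  proof -
    have "((step a \<circ> ereal) \<longlongrightarrow> (if x \<ge> a then 1 else 0)) (at_right x)"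
    proof (rule tendsto_eventually)
      show "\<forall>\<^sub>F y in at_right x. (step a \<circ> ereal) y = (if x \<ge> a then 1 else 0)"
        unfolding eventually_at_right_field
        by (cases "x \<ge> a") (auto simp: step_def intro!: exI[of _ "if x \<ge> a then x + 1 else a"])
    qed
    then show ?thesis by blast
  qed
  ultimately show ?thesis
    by (simp add: B_r_iff step_def)
qed

lemma not_separable_B_r: "\<not> separable_space (norm_topology B_r B_norm)"
  unfolding separable_norm_topology[OF subspace_B_r norm_on_B_r]
proof
  assume "\<exists>C. countable C \<and> C \<subseteq> B_r \<and> (\<forall>F\<in>B_r. \<forall>r>0. \<exists>G\<in>C. B_norm (F - G) < r)"
  then obtain C where C: "countable C" "C \<subseteq> B_r"
    and "\<And>a. \<exists>G\<in>C. B_norm (step a - G) < 1 / 2"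
    using step_in_B_r by (metis half_gt_zero zero_less_one)
  then obtain c where c: "\<And>a. c a \<in> C" "\<And>a. B_norm (step a - c a) < 1 / 2"
    by metis
  have near: "\<bar>step a x - c a x\<bar> < 1 / 2" for a x
  proof -
    have "c a \<in> B_r" using c(1) C(2) by blast
    then have "\<bar>(step a - c a) x\<bar> \<le> B_norm (step a - c a)"
      by (intro abs_le_B_norm subspace_diff[OF subspace_B_r] step_in_B_r)
    then show ?thesis using c(2)[of a] by simp
  qed
  have ne: "c a \<noteq> c b" if "a < b" for a b
  proof
    assume "c a = c b"
    then show False
      \<comment> \<open>For a < b the point b separates: \<open>step a\<close> is 1 there and
        \<open>step b\<close> is still 0, and no number lies within less than 1 / 2 of both.\<close>
      using near[of a "ereal b"] near[of b "ereal b"] that by (simp add: step_def)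
  qed
  have "inj c"
  proof (rule injI, rule ccontr)
    fix a b assume "c a = c b" "a \<noteq> b"
    then show False using ne[of a b] ne[of b a] by (cases a b rule: linorder_cases) auto
  qed
  then have "countable (UNIV :: real set)"
    using countable_image_inj_eq[of c UNIV] C(1) c(1) by (auto intro: countable_subset[of "range c" C])
  then show False
    by (simp add: uncountable_UNIV_real)
qed


section \<open>Approximation in \<open>B_c\<close> by polynomials in the hyperbolic tangent\<close>

definition tanh_ereal :: "ereal \<Rightarrow> real" where
  "tanh_ereal x = (if x = \<infinity> then 1 else if x = - \<infinity> then - 1 else tanh (real_of_ereal x))"

lemma tanh_ereal_simps [simp]:
  "tanh_ereal (ereal x) = tanh x" "tanh_ereal \<infinity> = 1" "tanh_ereal (- \<infinity>) = - 1"
  by (simp_all add: tanh_ereal_def)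

lemma tanh_ereal_comp: "tanh_ereal \<circ> ereal = tanh"
  by auto

lemma continuous_on_tanh_ereal: "continuous_on UNIV tanh_ereal"
  unfolding continuous_on_ereal_iff tanh_ereal_comp tanh_ereal_simps
  using tanh_real_at_top tanh_real_at_bot
  by (auto intro!: continuous_at_imp_continuous_on DERIV_isCont derivative_eq_intros)

lemma tanh_ereal_bounds: "tanh_ereal x \<in> {-1..1}"
  using tanh_real_bounds by (cases x) (auto simp: less_imp_le)

lemma tanh_ereal_inj: "tanh_ereal x = tanh_ereal y \<longleftrightarrow> x = y"
proof -
  have ne: "tanh r \<noteq> 1" "tanh r \<noteq> - 1" for r :: real
    using tanh_real_bounds[of r] by auto
  show ?thesis
    by (cases x; cases y) (use ne ne[symmetric] in simp_all)
qed

text \<open>-1 is the value of \<open>tanh_ereal\<close> at -\<infinity>, so the subtraction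
  enforces the normalisation in \<open>B_c\<close>.\<close>

definition poly_tanh :: "real poly \<Rightarrow> ereal \<Rightarrow> real" where
  "poly_tanh p x = poly p (tanh_ereal x) - poly p (- 1)"

lemma poly_tanh_in_B_c: "poly_tanh p \<in> B_c"
  unfolding B_c_def poly_tanh_def
  by (auto intro!: continuous_intros continuous_on_compose2[of UNIV "poly p"] continuous_on_tanh_ereal
      continuous_on_poly)

lemma smooth_poly_tanh_ereal: "smooth (poly_tanh p \<circ> ereal)"
proof -
  have "poly_tanh p \<circ> ereal = (\<lambda>x. poly (p - [:poly p (- 1):]) (tanh x))"
    by (auto simp: poly_tanh_def)
  then show ?thesis
    by (simp only: smooth_poly_tanh)
qed

lemma poly_tanh_dense:
  assumes F: "F \<in> B_c" and "e > 0"
  obtains p where "B_norm (F - poly_tanh p) < e"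
proof -
  interpret function_ring_on "range (\<lambda>p x. poly p (tanh_ereal x))" UNIV
  proof
    show "compact (UNIV :: ereal set)"
      by (rule compact_UNIV)
    fix f g :: "ereal \<Rightarrow> real"
    assume "f \<in> range (\<lambda>p x. poly p (tanh_ereal x))"
    then obtain p where p: "f = (\<lambda>x. poly p (tanh_ereal x))"
      by blast
    show "continuous_on UNIV f"
      unfolding p by (rule continuous_on_poly[OF continuous_on_tanh_ereal])
    assume "g \<in> range (\<lambda>p x. poly p (tanh_ereal x))"
    then obtain q where q: "g = (\<lambda>x. poly q (tanh_ereal x))"
      by blast
    show "(\<lambda>x. f x + g x) \<in> range (\<lambda>p x. poly p (tanh_ereal x))"
      by (rule range_eqI[of _ _ "p + q"]) (simp add: p q)
    show "(\<lambda>x. f x * g x) \<in> range (\<lambda>p x. poly p (tanh_ereal x))"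
      by (rule range_eqI[of _ _ "p * q"]) (simp add: p q)
  next
    show "(\<lambda>_. c) \<in> range (\<lambda>p x. poly p (tanh_ereal x))" for c
      by (rule range_eqI[of _ _ "[:c:]"]) simp
    show "\<exists>f\<in>range (\<lambda>p x. poly p (tanh_ereal x)). f x \<noteq> f y" if "x \<noteq> y" for x y
      using that by (intro bexI[of _ "\<lambda>x. poly [:0, 1:] (tanh_ereal x)"] rangeI) (simp add: tanh_ereal_inj)
  qed
  have "continuous_on UNIV F"
    using F by (simp add: B_c_def)
  moreover have "e / 4 > 0" using \<open>e > 0\<close> by simp
  ultimately obtain g where "g \<in> range (\<lambda>p x. poly p (tanh_ereal x))" and g: "\<forall>x\<in>UNIV. \<bar>F x - g x\<bar> < e / 4"
    using Stone_Weierstrass_basic by blast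
  then obtain p where p: "g = (\<lambda>x. poly p (tanh_ereal x))" by blast
  have near: "\<bar>F x - poly p (tanh_ereal x)\<bar> < e / 4" for x
    using g p by simp
  have *: "\<bar>F x - poly_tanh p x\<bar> < e / 2" for x
  proof -
    \<comment> \<open>\<open>F\<close> vanishes at -\<infinity>, so the constant removed by
      \<open>poly_tanh\<close> is itself part of the approximation error; the two quarters add up to
      e / 2.\<close>
    have "\<bar>poly p (- 1)\<bar> < e / 4"
      using F near[of "- \<infinity>"] by (simp add: B_c_def)
    then show ?thesis
      unfolding poly_tanh_def using near[of x] by linarith
  qed
  have "B_norm (F - poly_tanh p) \<le> e / 2"
    using * by (intro B_norm_le) (simp add: less_imp_le)
  then show thesis using \<open>e > 0\<close> that[of p] by simp
qed

text \<open>Horner's scheme drives the induction: for s in [-1, 1] multiplying the tail by s does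
  not enlarge its error, so half of e goes to the constant coefficient and half to the tail.
  Coefficient lists are used because \<open>rat list\<close> is a countable type.\<close>

lemma rational_poly_approx:
  fixes p :: "real poly"
  assumes "e > 0"
  shows "\<exists>l :: rat list. \<forall>s\<in>{-1..1}. \<bar>poly p s - poly (Poly (map of_rat l)) s\<bar> < e"
  using assms
proof (induction p arbitrary: e)
  case 0
  then show ?case by (intro exI[of _ "[]"]) simp
next
  case (pCons a p)
  then obtain l :: "rat list" where l: "\<And>s. s \<in> {-1..1} \<Longrightarrow> \<bar>poly p s - poly (Poly (map of_rat l)) s\<bar> < e / 2"
    by (meson half_gt_zero)
  obtain r :: rat where r: "a < of_rat r" "of_rat r < a + e / 2"
    using of_rat_dense[of a "a + e / 2"] pCons.prems by auto
  have "\<bar>poly (pCons a p) s - poly (Poly (map of_rat (r # l))) s\<bar> < e" if s: "s \<in> {-1..1}" for s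
  proof -
    define d where "d = poly p s - poly (Poly (map of_rat l)) s"
    have "\<bar>s * d\<bar> \<le> \<bar>d\<bar>"
      using s by (auto simp: abs_mult intro!: mult_left_le_one_le)
    moreover have "\<bar>d\<bar> < e / 2"
      using l[OF s] by (simp add: d_def)
    moreover have "poly (pCons a p) s - poly (Poly (map of_rat (r # l))) s = (a - of_rat r) + s * d"
      by (simp add: d_def algebra_simps)
    ultimately show ?thesis
      using r by linarith
  qed
  then show ?case by blast
qed

lemma separable_B_c: "separable_space (norm_topology B_c B_norm)"
  unfolding separable_norm_topology[OF subspace_B_c norm_on_B_c]
proof (intro exI conjI ballI allI impI)
  let ?q = "\<lambda>l :: rat list. Poly (map of_rat l) :: real poly"
  show "countable (range (\<lambda>l. poly_tanh (?q l)))"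
    by (rule countable_image) simp
  show "range (\<lambda>l. poly_tanh (?q l)) \<subseteq> B_c"
    using poly_tanh_in_B_c by blast
  fix F and r :: real assume F: "F \<in> B_c" and r: "r > 0"
  obtain p where p: "B_norm (F - poly_tanh p) < r / 2"
    using poly_tanh_dense[OF F, of "r / 2"] r by auto
  \<comment> \<open>The budget is r / 2 for the real polynomial and twice r / 8 for its rational
    replacement, once at the point itself and once at -1, where \<open>poly_tanh\<close> is
    normalised: 3 * r / 4 in all.\<close>
  have "r / 8 > 0" using r by simp
  from rational_poly_approx[OF this, of p]
  obtain l where l: "\<And>s. s \<in> {-1..1} \<Longrightarrow> \<bar>poly p s - poly (?q l) s\<bar> < r / 8"
    by blast
  have diff: "F - poly_tanh p \<in> B_r"
    using F poly_tanh_in_B_c by (intro subspace_diff[OF subspace_B_r] B_c_imp_B_r)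
  have "\<bar>(F - poly_tanh (?q l)) (ereal x)\<bar> \<le> 3 * r / 4" for x
  proof -
    have "\<bar>F (ereal x) - poly_tanh p (ereal x)\<bar> < r / 2"
      using abs_le_B_norm[OF diff, of "ereal x"] p by simp
    moreover have "\<bar>poly p (- 1) - poly (?q l) (- 1)\<bar> < r / 8"
      by (rule l) simp
    ultimately have "\<bar>F (ereal x) - poly_tanh (?q l) (ereal x)\<bar> \<le> 3 * r / 4"
      using l[OF tanh_ereal_bounds[of "ereal x"]] unfolding poly_tanh_def by linarith
    then show ?thesis by simp
  qed
  then have "B_norm (F - poly_tanh (?q l)) \<le> 3 * r / 4"
    by (rule B_norm_le)
  then show "\<exists>G\<in>range (\<lambda>l. poly_tanh (?q l)). B_norm (F - G) < r"
    using r by (intro bexI[of _ "poly_tanh (?q l)"]) auto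
qed

text \<open>The derivative is a polynomial evaluated at tanh, whose values stay in the compact
  interval [-1, 1]; hence it is bounded.\<close>

lemma poly_tanh_lipschitz:
  obtains L where "L \<ge> 0" "\<And>x y. \<bar>poly_tanh p (ereal x) - poly_tanh p (ereal y)\<bar> \<le> L * \<bar>x - y\<bar>"
proof -
  let ?d = "poly (pderiv p * [:1, 0, -1:])"
  have "bounded (?d ` {-1..1})"
    by (intro compact_imp_bounded compact_continuous_image continuous_on_poly continuous_on_id compact_Icc)
  then obtain L where L: "L > 0" "\<forall>y\<in>?d ` {-1..1}. norm y \<le> L"
    unfolding bounded_pos by blast
  have "norm (poly p (tanh x) - poly p (tanh y)) \<le> L * norm (x - y)" for x y
  proof (rule field_differentiable_bound[of UNIV])
    show "norm (?d (tanh z)) \<le> L" for z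
      using bspec[OF L(2) imageI[OF tanh_ereal_bounds[of "ereal z"]]] by simp
  qed (use DERIV_poly_tanh in auto)
  then show thesis
    using L by (intro that[of L]) (auto simp: poly_tanh_def)
qed

text \<open>\<open>F\<close> and its translate lie within e / 4 of \<open>poly_tanh p\<close> and of
  its translate, uniformly. The Lipschitz bound makes these two differ by less than another e / 4
  for small t.\<close>

lemma B_c_translate_tendsto:
  assumes F: "F \<in> B_c"
  shows "((\<lambda>t. B_norm (F - (\<lambda>x. F (x - ereal t)))) \<longlongrightarrow> 0) (at 0)"
proof (rule tendstoI)
  fix e :: real assume e: "e > 0"
  obtain p where p: "B_norm (F - poly_tanh p) < e / 4"
    using poly_tanh_dense[OF F, of "e / 4"] e by auto
  obtain L where L: "L \<ge> 0" "\<And>x y. \<bar>poly_tanh p (ereal x) - poly_tanh p (ereal y)\<bar> \<le> L * \<bar>x - y\<bar>"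
    using poly_tanh_lipschitz by blast
  have "F - poly_tanh p \<in> B_r"
    using F poly_tanh_in_B_c by (intro subspace_diff[OF subspace_B_r] B_c_imp_B_r)
  then have near: "\<bar>F x - poly_tanh p x\<bar> < e / 4" for x
    using abs_le_B_norm[of _ x] p by fastforce
  \<comment> \<open>The 1 guards against \<open>L\<close> = 0.\<close>
  have small: "B_norm (F - (\<lambda>x. F (x - ereal t))) < e" if t: "\<bar>t\<bar> < e / (4 * (L + 1))" for t
  proof -
    have "L * \<bar>t\<bar> \<le> (L + 1) * \<bar>t\<bar>"
      by (simp add: mult_right_mono)
    also have "\<dots> < e / 4"
      using t L(1) by (simp add: field_simps)
    finally have Lt: "L * \<bar>t\<bar> < e / 4" .
    have "\<bar>(F - (\<lambda>x. F (x - ereal t))) (ereal x)\<bar> \<le> 3 * e / 4" for x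
    proof -
      have "\<bar>poly_tanh p (ereal x) - poly_tanh p (ereal (x - t))\<bar> \<le> L * \<bar>t\<bar>"
        using L(2)[of x "x - t"] by simp
      then have "\<bar>F (ereal x) - F (ereal (x - t))\<bar> \<le> 3 * e / 4"
        using near[of "ereal x"] near[of "ereal (x - t)"] Lt by linarith
      then show ?thesis by simp
    qed
    then have "B_norm (F - (\<lambda>x. F (x - ereal t))) \<le> 3 * e / 4"
      by (rule B_norm_le)
    then show ?thesis using e by simp
  qed
  have nonneg: "B_norm (F - (\<lambda>x. F (x - ereal t))) \<ge> 0" for t
    using norm_on_B_r subspace_diff[OF subspace_B_r B_c_imp_B_r[OF F] B_r_translate[OF B_c_imp_B_r[OF F]]]
    by (simp add: norm_on_def)
  have "e / (4 * (L + 1)) > 0"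
    using e L(1) by simp
  then show "\<forall>\<^sub>F t in at 0. dist (B_norm (F - (\<lambda>x. F (x - ereal t)))) 0 < e"
    unfolding eventually_at using small nonneg
    by (intro exI[of _ "e / (4 * (L + 1))"]) (simp add: dist_real_def)
qed


section \<open>Distributional derivatives of regulated functions\<close>

definition B_deriv :: "nat \<Rightarrow> (ereal \<Rightarrow> real) \<Rightarrow> distribution" where
  "B_deriv n F = dist_deriv n (of_fun (F \<circ> ereal))"

lemma A_r_eq: "A_r n = B_deriv n ` B_r"
  and A_c_eq: "A_c n = B_deriv n ` B_c"
  by (auto simp: A_r_def A_c_def B_deriv_def)

lemma pairing_B_deriv:
  assumes "F \<in> B_r"
  shows "\<langle>B_deriv n F, \<phi>\<rangle> = (- 1) ^ n * (LINT x|lebesgue. F (ereal x) * (deriv ^^ n) (apply_test \<phi>) x)"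
  using B_r_locally_integrable[OF assms]
  by (simp add: B_deriv_def dist_deriv.rep_eq pairing_of_fun apply_test_deriv_funpow)

lemma B_deriv_lincomb:
  assumes "F \<in> B_r" "G \<in> B_r"
  shows "B_deriv n (a *\<^sub>R F + b *\<^sub>R G) = a *\<^sub>R B_deriv n F + b *\<^sub>R B_deriv n G"
proof -
  have "(a *\<^sub>R F + b *\<^sub>R G) \<circ> ereal = (\<lambda>x. a * (F \<circ> ereal) x + b * (G \<circ> ereal) x)"
    by auto
  then have "of_fun ((a *\<^sub>R F + b *\<^sub>R G) \<circ> ereal)
      = a *\<^sub>R of_fun (F \<circ> ereal) + b *\<^sub>R of_fun (G \<circ> ereal)"
    using of_fun_lincomb[OF assms[THEN B_r_locally_integrable], of a b] by (simp only:)
  then show ?thesis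
    using linear_dist_deriv[of n] by (simp add: B_deriv_def linear_add linear_scale)
qed

lemmas B_deriv_lincomb_B_c = B_deriv_lincomb[OF B_c_imp_B_r B_c_imp_B_r]

text \<open>\<open>F\<close> and a smooth function define the same distribution, and left continuity
  of both turns this into equality at every point; so the primitive of a smooth element has no
  jump.\<close>

lemma B_deriv_eq_smooth:
  assumes F: "F \<in> B_r" and "B_deriv n F = of_fun g" "smooth g"
  shows "continuous_on UNIV (F \<circ> ereal)"
proof -
  obtain G where G: "smooth G" "of_fun (F \<circ> ereal) = of_fun G"
    using assms dist_deriv_eq_of_fun_smooth unfolding B_deriv_def by metis
  have "(G \<longlongrightarrow> G x) (at_left x)" for x
    using continuous_on_smooth[OF G(1), of UNIV]
    by (auto simp: continuous_on_def intro: tendsto_within_subset)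
  then have "F \<circ> ereal = G"
    using F G by (intro of_fun_left_continuous_inject B_r_locally_integrable locally_integrable_smooth)
      (auto simp: B_r_iff)
  then show ?thesis
    using continuous_on_smooth[OF G(1)] by simp
qed

lemma B_deriv_eq_0:
  assumes F: "F \<in> B_r" and "B_deriv n F = 0"
  shows "F = 0"
proof -
  have "of_fun (poly 0) = 0"
    by (rule distribution_eqI)
      (simp add: pairing_of_fun locally_integrable_smooth smooth_poly zero_distribution.rep_eq)
  then obtain q where q: "of_fun (F \<circ> ereal) = of_fun (poly q)"
    using assms dist_deriv_eq_of_fun_poly unfolding B_deriv_def by metis
  have "(poly q \<longlongrightarrow> poly q x) (at_left x)" for x
    using continuous_on_smooth[OF smooth_poly, of UNIV q]
    by (auto simp: continuous_on_def intro: tendsto_within_subset)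
  then have Fq: "F \<circ> ereal = poly q"
    using F q by (intro of_fun_left_continuous_inject B_r_locally_integrable locally_integrable_smooth smooth_poly)
      (auto simp: B_r_iff)
  then have lim: "(poly q \<longlongrightarrow> 0) at_bot" "(poly q \<longlongrightarrow> F \<infinity>) at_top"
    using F by (simp_all add: B_r_iff)
  have "degree q = 0"
  proof (rule ccontr)
    assume "degree q \<noteq> 0"
    then have "filterlim (poly q) at_infinity at_bot"
      using filterlim_mono[OF filterlim_poly_at_infinity order_refl at_bot_le_at_infinity] by simp
    then show False
      using not_tendsto_and_filterlim_at_infinity[OF _ lim(1)] by simp
  qed
  then obtain c where "q = [:c:]"
    by (rule degree_eq_zeroE)
  then have c: "poly q = (\<lambda>x. c)"
    by auto
  have "c = 0"
    using lim(1) unfolding c by (simp add: tendsto_const_iff)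
  \<comment> \<open>The distribution sees only real points; the value at \<infinity> is recovered
    from the limit.\<close>
  then have "F \<infinity> = 0"
    using lim(2) unfolding c by (simp add: tendsto_const_iff)
  moreover have "F (ereal x) = 0" for x
    using Fq c \<open>c = 0\<close> by (metis comp_apply)
  moreover have "F (- \<infinity>) = 0"
    using F by (simp add: B_r_iff)
  ultimately show "F = 0"
    by (simp add: fun_eq_iff ereal_all_split)
qed

lemma B_deriv_inject:
  assumes "F \<in> B_r" "G \<in> B_r"
  shows "B_deriv n F = B_deriv n G \<longleftrightarrow> F = G"
proof
  assume "B_deriv n F = B_deriv n G"
  then have "B_deriv n (F - G) = 0"
    using B_deriv_lincomb[OF assms, of n 1 "- 1"] by simp
  then have "F - G = 0"
    by (rule B_deriv_eq_0[OF subspace_diff[OF subspace_B_r assms]])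
  then show "F = G" by simp
qed simp

text \<open>Injectivity of \<open>B_deriv n\<close> on \<open>B_r\<close> is what makes the definite
  description in \<open>primitive\<close> evaluate.\<close>

lemma A_norm_B_deriv:
  assumes "F \<in> B_r"
  shows "A_norm n (B_deriv n F) = B_norm F"
proof -
  have "primitive n (B_deriv n F) = F"
    unfolding primitive_def using assms B_deriv_inject[of _ F n]
    by (intro the_equality) (auto simp: B_deriv_def)
  then show ?thesis by (simp add: A_norm_def)
qed

lemma isometrically_isomorphic_B_deriv:
  assumes "S \<subseteq> B_r"
  shows "isometrically_isomorphic S B_norm (B_deriv n ` S) (A_norm n)"
  unfolding isometrically_isomorphic_def
proof (intro exI conjI allI ballI)
  show "bij_betw (B_deriv n) S (B_deriv n ` S)"
    using assms B_deriv_inject by (intro inj_on_imp_bij_betw inj_onI) blast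
qed (use assms in \<open>auto intro!: B_deriv_lincomb A_norm_B_deriv\<close>)

section \<open>Structure of \<open>A_r n\<close> and \<open>A_c n\<close> inherited through
  \<open>B_deriv n\<close>\<close>

lemma subspace_A_r: "subspace (A_r n)"
  unfolding A_r_eq by (rule subspace_image[where \<Phi>="B_deriv n", OF subspace_B_r B_deriv_lincomb])

lemma subspace_A_c: "subspace (A_c n)"
  unfolding A_c_eq by (rule subspace_image[where \<Phi>="B_deriv n", OF subspace_B_c B_deriv_lincomb_B_c])

lemma norm_on_A_r: "norm_on (A_r n) (A_norm n)"
  unfolding A_r_eq
  using subspace_B_r B_deriv_lincomb A_norm_B_deriv norm_on_B_r by (rule norm_on_image)

lemma banach_on_A_r: "banach_on (A_r n) (A_norm n)"
  unfolding A_r_eq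
  using subspace_B_r B_deriv_lincomb A_norm_B_deriv norm_on_B_r banach_on_B_r by (rule banach_on_image)

lemma banach_on_A_c: "banach_on (A_c n) (A_norm n)"
  unfolding A_c_eq
  using subspace_B_c B_deriv_lincomb_B_c A_norm_B_deriv[OF B_c_imp_B_r] norm_on_B_c banach_on_B_c
  by (rule banach_on_image)

lemma A_c_subset_A_r: "A_c n \<subseteq> A_r n"
  unfolding A_c_eq A_r_eq using B_c_subset_B_r by (rule image_mono)

lemma norm_on_A_c: "norm_on (A_c n) (A_norm n)"
  using norm_on_A_r A_c_subset_A_r by (rule norm_on_subset)

lemma not_separable_A_r: "\<not> separable_space (norm_topology (A_r n) (A_norm n))"
  unfolding A_r_eq using not_separable_B_r
    separable_norm_topology_image[where \<Phi>="B_deriv n" and N'="A_norm n",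
      OF subspace_B_r B_deriv_lincomb A_norm_B_deriv norm_on_B_r] by simp

lemma separable_A_c: "separable_space (norm_topology (A_c n) (A_norm n))"
  unfolding A_c_eq using separable_B_c
    separable_norm_topology_image[where \<Phi>="B_deriv n" and N'="A_norm n",
      OF subspace_B_c B_deriv_lincomb_B_c A_norm_B_deriv[OF B_c_imp_B_r] norm_on_B_c]
  by simp

lemma A_norm_diff:
  assumes "F \<in> B_r" "G \<in> B_r"
  shows "A_norm n (B_deriv n F - B_deriv n G) = B_norm (F - G)"
proof -
  have "B_deriv n F - B_deriv n G = B_deriv n (F - G)"
    using B_deriv_lincomb[OF assms, of n 1 "- 1"] by simp
  then show ?thesis
    using A_norm_B_deriv[OF subspace_diff[OF subspace_B_r assms]] by metis
qed


section \<open>Order and temperedness\<close>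

lemma bounded_test: "bounded (range (apply_test \<phi>))"
proof -
  have "bounded (apply_test \<phi> ` supp (apply_test \<phi>))"
    by (intro compact_imp_bounded compact_continuous_image continuous_on_smooth smooth_test compact_supp_test)
  then have "bounded (insert 0 (apply_test \<phi> ` supp (apply_test \<phi>)))"
    by simp
  then show ?thesis
    by (rule bounded_subset) (use not_in_supp in auto)
qed

lemma abs_deriv_test_le_sup_norm:
  "\<bar>(deriv ^^ k) (apply_test \<phi>) x\<bar> \<le> sup_norm ((deriv ^^ k) (apply_test \<phi>))"
  using bounded_test[of "(test_deriv ^^ k) \<phi>"]
  unfolding sup_norm_def apply_test_deriv_funpow bounded_iff
  by (intro cSUP_upper) (auto simp: bdd_above_def)

lemma supp_higher_deriv: "supp ((deriv ^^ k) g) \<subseteq> supp g"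
  by (induction k) (use supp_deriv_subset in force)+

text \<open>The n-th derivative vanishes off \<open>K\<close>, so the pairing is at most
  \<open>B_norm F\<close> times the measure of \<open>K\<close> times the supremum of that
  derivative, which is the last summand.\<close>

lemma order_at_most_B_deriv:
  assumes F: "F \<in> B_r"
  shows "order_at_most n (B_deriv n F)"
  unfolding order_at_most_def
proof (intro allI impI)
  fix K :: "real set" assume K: "compact K"
  have K': "K \<in> lmeasurable" using K by (rule lmeasurable_compact)
  have nonneg: "B_norm F \<ge> 0"
    using norm_on_B_r F by (simp add: norm_on_def)
  show "\<exists>C\<ge>0. \<forall>\<phi>. supp (apply_test \<phi>) \<subseteq> K \<longrightarrow>
      \<bar>\<langle>B_deriv n F, \<phi>\<rangle>\<bar> \<le> C * (\<Sum>k\<le>n. sup_norm ((deriv ^^ k) (apply_test \<phi>)))"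
  proof (intro exI conjI allI impI)
    show "B_norm F * measure lebesgue K \<ge> 0"
      using nonneg by simp
    fix \<phi> assume \<phi>: "supp (apply_test \<phi>) \<subseteq> K"
    let ?g = "(deriv ^^ n) (apply_test \<phi>)"
    have out: "?g x = 0" if "x \<notin> K" for x
      using that \<phi> supp_higher_deriv not_in_supp by blast
    have s: "sup_norm ((deriv ^^ k) (apply_test \<phi>)) \<ge> 0" for k
      using abs_deriv_test_le_sup_norm[of k \<phi> 0] by linarith
    have int: "integrable lebesgue (\<lambda>x. F (ereal x) * ?g x)"
      using integrable_mult_test[OF B_r_locally_integrable[OF F], of "(test_deriv ^^ n) \<phi>"]
      by (simp add: apply_test_deriv_funpow)
    have "\<bar>\<langle>B_deriv n F, \<phi>\<rangle>\<bar> = \<bar>LINT x|lebesgue. F (ereal x) * ?g x\<bar>"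
      by (simp add: pairing_B_deriv[OF F] abs_mult power_abs)
    also have "\<dots> \<le> (LINT x|lebesgue. \<bar>F (ereal x) * ?g x\<bar>)"
      by (rule integral_abs_bound)
    also have "\<dots> \<le> (LINT x|lebesgue. indicator K x * (B_norm F * sup_norm ?g))"
    proof (rule integral_mono)
      show "integrable lebesgue (\<lambda>x. indicator K x * (B_norm F * sup_norm ?g))"
        using K' by (intro integrable_mult_left integrable_real_indicator) (auto simp: fmeasurable_def)
      show "\<bar>F (ereal x) * ?g x\<bar> \<le> indicator K x * (B_norm F * sup_norm ?g)" for x
        using out[of x] mult_mono[OF abs_le_B_norm[OF F, of "ereal x"] abs_deriv_test_le_sup_norm[of n \<phi> x]] nonneg
        by (cases "x \<in> K") (auto simp: abs_mult)
    qed (use int in auto)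
    also have "\<dots> = B_norm F * measure lebesgue K * sup_norm ?g"
      using K' by (simp add: fmeasurable_def)
    also have "\<dots> \<le> B_norm F * measure lebesgue K * (\<Sum>k\<le>n. sup_norm ((deriv ^^ k) (apply_test \<phi>)))"
      using nonneg s by (intro mult_left_mono member_le_sum) auto
    finally show "\<bar>\<langle>B_deriv n F, \<phi>\<rangle>\<bar>
        \<le> B_norm F * measure lebesgue K * (\<Sum>k\<le>n. sup_norm ((deriv ^^ k) (apply_test \<phi>)))" .
  qed
qed

lemma integrable_inverse_1_plus_square_lebesgue:
  "integrable lebesgue (\<lambda>x::real. inverse (1 + x\<^sup>2))"
proof -
  have "integrable lborel (\<lambda>x::real. inverse (1 + x\<^sup>2))"
    using integrable_inverse_1_plus_square by (simp add: set_integrable_def)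
  then show ?thesis
    by (subst integrable_completion) simp_all
qed

text \<open>Combines the Schwartz bounds for the weights x^0 and x^2 into domination by an
  integrable function.\<close>

lemma abs_le_inverse_1_plus_square:
  fixes y :: real
  assumes "\<bar>y\<bar> \<le> C" "\<bar>x\<^sup>2 * y\<bar> \<le> D"
  shows "\<bar>y\<bar> \<le> (C + D) * inverse (1 + x\<^sup>2)"
proof -
  have "\<bar>y\<bar> * (1 + x\<^sup>2) = \<bar>y\<bar> + \<bar>x\<^sup>2 * y\<bar>"
    by (simp add: abs_mult algebra_simps)
  also have "\<dots> \<le> C + D"
    using assms by linarith
  finally show ?thesis
    by (simp add: divide_inverse[symmetric] pos_le_divide_eq add_pos_nonneg)
qed

text \<open>The integral formula for the pairing already makes sense on Schwartz functions, as
  \<open>F\<close> is bounded and the n-th derivative is dominated by a multiple of 1 / (1 + x^2).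
  This formula, \<open>S\<close>, is the required extension.\<close>

lemma tempered_B_deriv:
  assumes F: "F \<in> B_r"
  shows "tempered (B_deriv n F)"
proof -
  define S where "S = (\<lambda>\<phi>. (- 1) ^ n * (LINT x|lebesgue. F (ereal x) * (deriv ^^ n) \<phi> x))"
  let ?w = "\<lambda>x::real. inverse (1 + x\<^sup>2)"
  have F_meas: "(\<lambda>x. F (ereal x)) \<in> borel_measurable lebesgue"
    using B_r_measurable[OF F] by (intro measurable_completion) (simp add: o_def)
  have nonneg: "B_norm F \<ge> 0"
    using norm_on_B_r F by (simp add: norm_on_def)
  have w_int: "integrable lebesgue (\<lambda>x. c * ?w x)" for c
    using integrable_inverse_1_plus_square_lebesgue by simp
  have bound: "\<bar>F (ereal x) * y\<bar> \<le> B_norm F * (C + D) * ?w x"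
    if "\<bar>y\<bar> \<le> C" "\<bar>x\<^sup>2 * y\<bar> \<le> D" for x y C D
  proof -
    have "\<bar>F (ereal x)\<bar> * \<bar>y\<bar> \<le> B_norm F * ((C + D) * ?w x)"
      using abs_le_B_norm[OF F] abs_le_inverse_1_plus_square[OF that] nonneg by (intro mult_mono) auto
    then show ?thesis by (simp add: abs_mult mult.assoc)
  qed
  have int: "integrable lebesgue (\<lambda>x. F (ereal x) * (deriv ^^ n) \<phi> x)" if \<phi>: "\<phi> \<in> schwartz" for \<phi>
  proof -
    have smooth: "smooth \<phi>" and
      bdd: "bounded (range (\<lambda>x. x ^ m * (deriv ^^ n) \<phi> x))" for m
      using \<phi> by (auto simp: schwartz_def)
    obtain C where C: "\<And>x. \<bar>(deriv ^^ n) \<phi> x\<bar> \<le> C"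
      using bdd[of 0] by (auto simp: bounded_iff)
    obtain D where D: "\<And>x. \<bar>x\<^sup>2 * (deriv ^^ n) \<phi> x\<bar> \<le> D"
      using bdd[of 2] by (auto simp: bounded_iff)
    have "(deriv ^^ n) \<phi> \<in> borel_measurable lebesgue"
      using smooth by (intro measurable_completion)
        (simp add: borel_measurable_continuous_onI continuous_on_smooth smooth_higher_deriv)
    then have meas: "(\<lambda>x. F (ereal x) * (deriv ^^ n) \<phi> x) \<in> borel_measurable lebesgue"
      using F_meas by (rule borel_measurable_times[rotated])
    show ?thesis
    proof (rule Bochner_Integration.integrable_bound[OF w_int meas])
      show "AE x in lebesgue. norm (F (ereal x) * (deriv ^^ n) \<phi> x) \<le> norm (B_norm F * (C + D) * ?w x)"
        using bound[OF C D] by (intro AE_I2) (metis abs_ge_self order_trans real_norm_def)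
    qed
  qed
  show ?thesis
    unfolding tempered_def
  proof (intro exI[of _ S] conjI allI ballI impI)
    fix a b \<phi> \<psi> assume \<phi>: "\<phi> \<in> schwartz" and \<psi>: "\<psi> \<in> schwartz"
    then have "smooth \<phi>" "smooth \<psi>" by (auto simp: schwartz_def)
    then have "(deriv ^^ n) (a *\<^sub>R \<phi> + b *\<^sub>R \<psi>) = (\<lambda>x. a * (deriv ^^ n) \<phi> x + b * (deriv ^^ n) \<psi> x)"
      using higher_deriv_lincomb[of \<phi> \<psi> n a b] by (simp add: plus_fun_def scaleR_fun_def)
    then show "S (a *\<^sub>R \<phi> + b *\<^sub>R \<psi>) = a * S \<phi> + b * S \<psi>"
      using int[OF \<phi>] int[OF \<psi>]
      by (simp add: S_def distrib_left mult.left_commute[of "F _"] mult.left_commute[of "(- 1) ^ n"])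
  next
    show "\<langle>B_deriv n F, \<phi>\<rangle> = S (apply_test \<phi>)" for \<phi>
      by (simp add: pairing_B_deriv[OF F] S_def)
  next
    fix \<phi>s \<phi> assume \<phi>s: "range \<phi>s \<subseteq> schwartz" and \<phi>: "\<phi> \<in> schwartz" and conv: "schwartz_conv \<phi>s \<phi>"
    define W where "W = (LINT x|lebesgue. ?w x)"
    have W: "W \<ge> 0" unfolding W_def by simp
    show "(\<lambda>j. S (\<phi>s j)) \<longlonglongrightarrow> S \<phi>"
    proof (rule tendstoI)
      fix r :: real assume r: "r > 0"
      \<comment> \<open>If both weighted differences are below e, the integrals differ by at most 2
        * e * \<open>B_norm F\<close> * \<open>W\<close> = r - e. The added 1 keeps the denominator
        positive and the final inequality strict.\<close>
      define e where "e = r / (2 * B_norm F * W + 1)"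
      have pos: "2 * B_norm F * W + 1 > 0"
        using nonneg W by (simp add: add_nonneg_pos)
      then have e: "e > 0"
        using r by (simp add: e_def)
      have "e * (2 * B_norm F * W + 1) = r"
        using pos by (simp add: e_def)
      then have small: "B_norm F * (e + e) * W < r"
        using e by (simp add: algebra_simps)
      have "\<forall>\<^sub>F j in sequentially. \<forall>x\<in>UNIV.
          dist (x ^ m * (deriv ^^ n) (\<phi>s j) x) (x ^ m * (deriv ^^ n) \<phi> x) < e" for m
        using conv unfolding schwartz_conv_def by (intro uniform_limitD[OF _ e]) simp
      from this[of 0] this[of 2]
      show "\<forall>\<^sub>F j in sequentially. dist (S (\<phi>s j)) (S \<phi>) < r"
      proof eventually_elim
        case (elim j)
        let ?d = "\<lambda>x. (deriv ^^ n) (\<phi>s j) x - (deriv ^^ n) \<phi> x"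
        have "\<bar>?d x\<bar> \<le> e" "\<bar>x\<^sup>2 * ?d x\<bar> \<le> e" for x
          using bspec[OF elim(1), of x] bspec[OF elim(2), of x]
          by (simp_all add: dist_real_def right_diff_distrib less_imp_le)
        note b = bound[OF this]
        have j: "\<phi>s j \<in> schwartz" using \<phi>s by blast
        have i: "integrable lebesgue (\<lambda>x. F (ereal x) * ?d x)"
          using int[OF j] int[OF \<phi>] by (simp add: right_diff_distrib)
        have "S (\<phi>s j) - S \<phi> = (- 1) ^ n * (LINT x|lebesgue. F (ereal x) * ?d x)"
          using int[OF j] int[OF \<phi>] by (simp add: S_def right_diff_distrib)
        then have "dist (S (\<phi>s j)) (S \<phi>) = \<bar>LINT x|lebesgue. F (ereal x) * ?d x\<bar>"
          by (simp add: dist_real_def abs_mult power_abs)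
        also have "\<dots> \<le> (LINT x|lebesgue. \<bar>F (ereal x) * ?d x\<bar>)"
          by (rule integral_abs_bound)
        also have "\<dots> \<le> (LINT x|lebesgue. B_norm F * (e + e) * ?w x)"
          using i w_int b by (intro integral_mono) auto
        also have "\<dots> = B_norm F * (e + e) * W"
          by (simp add: W_def)
        finally show ?case using small by simp
      qed
    qed
  qed
qed


section \<open>Translations\<close>

lemma integral_lebesgue_translate:
  fixes g :: "real \<Rightarrow> real"
  assumes "g \<in> borel_measurable borel"
  shows "(LINT x|lebesgue. g (x - t)) = (LINT x|lebesgue. g x)"
proof -
  have "(\<lambda>x. g (x - t)) \<in> borel_measurable borel"
    using assms by measurable
  then have "(LINT x|lebesgue. g (x - t)) = (LINT x|lborel. g (x - t))"
    by (intro integral_completion) simp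
  also have "\<dots> = (LINT x|lborel. g x)"
    using lborel_integral_real_affine[of 1 g "- t"] by simp
  also have "\<dots> = (LINT x|lebesgue. g x)"
    using assms by (intro integral_completion[symmetric]) simp
  finally show ?thesis .
qed

lemma dist_translate_B_deriv:
  assumes F: "F \<in> B_r"
  shows "dist_translate t (B_deriv n F) = B_deriv n (\<lambda>x. F (x - ereal t))"
proof (rule distribution_eqI)
  fix \<phi>
  let ?g = "(deriv ^^ n) (apply_test \<phi>)"
  have "(deriv ^^ n) (apply_test (test_translate (- t) \<phi>)) = (\<lambda>x. ?g (x + t))"
    using higher_deriv_shift[OF smooth_test, of n _ "- t"] by (simp add: test_translate.rep_eq)
  then have "\<langle>dist_translate t (B_deriv n F), \<phi>\<rangle> = (- 1) ^ n * (LINT x|lebesgue. F (ereal x) * ?g (x + t))"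
    by (simp add: dist_translate.rep_eq pairing_B_deriv[OF F])
  also have "(LINT x|lebesgue. F (ereal x) * ?g (x + t)) = (LINT x|lebesgue. F (ereal (x - t)) * ?g x)"
  proof -
    have "?g \<in> borel_measurable borel"
      by (intro borel_measurable_continuous_onI continuous_on_smooth smooth_higher_deriv smooth_test)
    then have "(\<lambda>x. F (ereal x) * ?g (x + t)) \<in> borel_measurable borel"
      using B_r_measurable[OF F] by (intro borel_measurable_times) (simp_all add: o_def)
    from integral_lebesgue_translate[OF this, of t] show ?thesis by simp
  qed
  finally show "\<langle>dist_translate t (B_deriv n F), \<phi>\<rangle> = \<langle>B_deriv n (\<lambda>x. F (x - ereal t)), \<phi>\<rangle>"
    by (simp add: pairing_B_deriv[OF B_r_translate[OF F]])
qed

lemma dist_translate_translate: "dist_translate (- t) (dist_translate t T) = T"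
proof (rule distribution_eqI)
  fix \<phi>
  have "test_translate (- t) (test_translate t \<phi>) = \<phi>"
    by (simp add: apply_test_inject[symmetric] test_translate.rep_eq)
  then show "\<langle>dist_translate (- t) (dist_translate t T), \<phi>\<rangle> = \<langle>T, \<phi>\<rangle>"
    by (simp add: dist_translate.rep_eq)
qed

lemma dist_translate_in_A_r: "T \<in> A_r n \<Longrightarrow> dist_translate t T \<in> A_r n"
  unfolding A_r_eq using dist_translate_B_deriv B_r_translate by (auto intro!: imageI)

lemma dist_translate_in_A_c: "T \<in> A_c n \<Longrightarrow> dist_translate t T \<in> A_c n"
  unfolding A_c_eq using dist_translate_B_deriv B_c_translate B_c_imp_B_r by (auto intro!: imageI)

lemma dist_translate_in_A_r_iff: "dist_translate t T \<in> A_r n \<longleftrightarrow> T \<in> A_r n"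
  using dist_translate_in_A_r[of _ n] dist_translate_translate[of t T] by metis

lemma dist_translate_in_A_c_iff: "dist_translate t T \<in> A_c n \<longleftrightarrow> T \<in> A_c n"
  using dist_translate_in_A_c[of _ n] dist_translate_translate[of t T] by metis

lemma commuting_dist_deriv:
  assumes "\<And>T. dist_deriv 1 (Op T) = Op (dist_deriv 1 T)"
  shows "dist_deriv n (Op T) = Op (dist_deriv n T)"
proof (induction n)
  case (Suc n)
  have "dist_deriv (Suc n) (Op T) = dist_deriv 1 (dist_deriv n (Op T))"
    using dist_deriv_add[of 1 n] by simp
  also have "\<dots> = Op (dist_deriv 1 (dist_deriv n T))"
    using Suc assms by simp
  also have "dist_deriv 1 (dist_deriv n T) = dist_deriv (Suc n) T"
    using dist_deriv_add[of 1 n] by simp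
  finally show ?case .
qed simp


section \<open>Density of smooth distributions\<close>

text \<open>For the smooth primitive \<open>poly_tanh p\<close> the distributional derivative is the
  classical one, so approximating primitives in \<open>B_norm\<close> approximates \<open>f\<close>
  by smooth distributions.\<close>

lemma smooth_dense_A_c:
  "norm_topology (A_c n) (A_norm n) closure_of (smooth_distributions \<inter> A_c n) = A_c n"
proof -
  have "\<exists>g\<in>smooth_distributions \<inter> A_c n. A_norm n (f - g) < r" if f: "f \<in> A_c n" and r: "r > 0" for f r
  proof -
    obtain F where F: "F \<in> B_c" "f = B_deriv n F"
      using f by (auto simp: A_c_eq)
    obtain p where p: "B_norm (F - poly_tanh p) < r"
      using poly_tanh_dense[OF F(1) r] by blast
    let ?g = "B_deriv n (poly_tanh p)"
    have "?g = of_fun ((deriv ^^ n) (poly_tanh p \<circ> ereal))"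
      unfolding B_deriv_def by (rule dist_deriv_of_fun_smooth[OF smooth_poly_tanh_ereal])
    then have "?g \<in> smooth_distributions"
      unfolding smooth_distributions_def using smooth_higher_deriv[OF smooth_poly_tanh_ereal] by blast
    moreover have "?g \<in> A_c n"
      unfolding A_c_eq using poly_tanh_in_B_c by blast
    moreover have "A_norm n (f - ?g) < r"
      using p F A_norm_diff B_c_imp_B_r poly_tanh_in_B_c by simp
    ultimately show ?thesis by blast
  qed
  then show ?thesis
    by (subst norm_topology_closure_of[OF subspace_A_c norm_on_A_c]) auto
qed

lemma smooth_not_dense_A_r:
  "norm_topology (A_r n) (A_norm n) closure_of (smooth_distributions \<inter> A_r n) \<noteq> A_r n"
proof
  assume "norm_topology (A_r n) (A_norm n) closure_of (smooth_distributions \<inter> A_r n) = A_r n"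
  moreover have "B_deriv n (step 0) \<in> A_r n"
    unfolding A_r_eq using step_in_B_r by blast
  ultimately have "B_deriv n (step 0) \<in>
      norm_topology (A_r n) (A_norm n) closure_of (smooth_distributions \<inter> A_r n)"
    by simp
  then have "\<forall>r>0. \<exists>f\<in>smooth_distributions \<inter> A_r n. A_norm n (B_deriv n (step 0) - f) < r"
    unfolding norm_topology_closure_of[OF subspace_A_r norm_on_A_r Int_lower2] by simp
  then have "\<exists>f\<in>smooth_distributions \<inter> A_r n. A_norm n (B_deriv n (step 0) - f) < 1 / 2"
    by (rule allE[of _ "1 / 2"]) simp
  then obtain f where f: "f \<in> smooth_distributions" "f \<in> A_r n" "A_norm n (B_deriv n (step 0) - f) < 1 / 2"
    by blast
  then obtain F g where F: "F \<in> B_r" "f = B_deriv n F" and g: "f = of_fun g" "smooth g"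
    by (auto simp: A_r_eq smooth_distributions_def)
  have cont: "continuous_on UNIV (F \<circ> ereal)"
    using F g by (intro B_deriv_eq_smooth[of F n g]) auto
  have near: "\<bar>step 0 x - F x\<bar> < 1 / 2" for x
  proof -
    have "\<bar>(step 0 - F) x\<bar> \<le> B_norm (step 0 - F)"
      using F(1) by (intro abs_le_B_norm subspace_diff[OF subspace_B_r] step_in_B_r)
    then show ?thesis
      using f(3) F A_norm_diff[OF step_in_B_r F(1)] by simp
  qed
  have "isCont (F \<circ> ereal) 0"
    using cont continuous_on_eq_continuous_at[OF open_UNIV] by blast
  then have "((F \<circ> ereal) \<longlongrightarrow> (F \<circ> ereal) 0) (at_right 0)"
    unfolding continuous_at by (rule tendsto_within_subset) simp
  \<comment> \<open>To the right of 0 the step is 1, which forces \<open>F\<close> above 1 / 2 there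
    and, by continuity, at least 1 / 2 at 0. But the step is 0 at 0, which forces \<open>F\<close>
    strictly below 1 / 2.\<close>
  moreover have "\<forall>\<^sub>F x in at_right 0. 1 / 2 \<le> (F \<circ> ereal) x"
  proof -
    have "1 / 2 \<le> F (ereal x)" if "x > 0" for x
    proof -
      have "\<bar>1 - F (ereal x)\<bar> < 1 / 2"
        using near[of "ereal x"] that by (simp add: step_def)
      then show ?thesis by linarith
    qed
    then show ?thesis
      by (simp add: eventually_at_filter)
  qed
  ultimately have "1 / 2 \<le> (F \<circ> ereal) 0"
    by (rule tendsto_lowerbound) simp
  then show False
    using near[of "ereal 0"] by (simp add: step_def abs_less_iff)
qed


theorem theorem3:
  fixes n :: nat and f f1 f2 :: distribution and F F1 F2 :: "ereal \<Rightarrow> real"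
    and a1 a2 :: real and \<phi> :: test_fun
  assumes n: "n \<ge> 1"
    and f: "f \<in> A_r n" "F \<in> B_r" "f = dist_deriv n (of_fun (F \<circ> ereal))"
    and f1: "f1 \<in> A_r n" "F1 \<in> B_r" "f1 = dist_deriv n (of_fun (F1 \<circ> ereal))"
    and f2: "f2 \<in> A_r n" "F2 \<in> B_r" "f2 = dist_deriv n (of_fun (F2 \<circ> ereal))"
  shows
    "(\<langle>a1 *\<^sub>R f1 + a2 *\<^sub>R f2, \<phi>\<rangle> = a1 * \<langle>f1, \<phi>\<rangle> + a2 * \<langle>f2, \<phi>\<rangle> \<and>
      a1 * \<langle>f1, \<phi>\<rangle> + a2 * \<langle>f2, \<phi>\<rangle> =
        (- 1) ^ n * (a1 * \<langle>of_fun (F1 \<circ> ereal), (test_deriv ^^ n) \<phi>\<rangle>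
                   + a2 * \<langle>of_fun (F2 \<circ> ereal), (test_deriv ^^ n) \<phi>\<rangle>) \<and>
      (- 1) ^ n * (a1 * \<langle>of_fun (F1 \<circ> ereal), (test_deriv ^^ n) \<phi>\<rangle>
                 + a2 * \<langle>of_fun (F2 \<circ> ereal), (test_deriv ^^ n) \<phi>\<rangle>) =
        (- 1) ^ n * (a1 * (LINT x|lebesgue. F1 (ereal x) * (deriv ^^ n) (apply_test \<phi>) x)
                   + a2 * (LINT x|lebesgue. F2 (ereal x) * (deriv ^^ n) (apply_test \<phi>) x)) \<and>
      subspace (A_r n) \<and> subspace (A_c n) \<and> A_c n \<subseteq> A_r n)
    \<and>
     (A_norm n f = B_norm F \<and> norm_on (A_r n) (A_norm n) \<and>
      banach_on (A_r n) (A_norm n) \<and>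
      \<not> separable_space (norm_topology (A_r n) (A_norm n)) \<and>
      isometrically_isomorphic (A_r n) (A_norm n) B_r B_norm \<and>
      banach_on (A_c n) (A_norm n) \<and>
      separable_space (norm_topology (A_c n) (A_norm n)) \<and>
      isometrically_isomorphic (A_c n) (A_norm n) B_c B_norm)
    \<and>
     (\<forall>g\<in>A_r n. tempered g \<and> order_at_most n g)
    \<and>
     (\<forall>Op :: distribution \<Rightarrow> distribution.
        (\<forall>T. dist_deriv 1 (Op T) = Op (dist_deriv 1 T)) \<longrightarrow>
        \<langle>Op f, \<phi>\<rangle> = (- 1) ^ n * \<langle>Op (of_fun (F \<circ> ereal)), (test_deriv ^^ n) \<phi>\<rangle>)
    \<and>
     (\<forall>t T. (T \<in> A_r n \<longleftrightarrow> dist_translate t T \<in> A_r n) \<and>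
            (T \<in> A_c n \<longleftrightarrow> dist_translate t T \<in> A_c n) \<and>
            A_norm n (dist_translate t f) = A_norm n f)
    \<and>
     (\<forall>g\<in>A_c n. ((\<lambda>t. A_norm n (g - dist_translate t g)) \<longlongrightarrow> 0) (at 0))
    \<and>
     (norm_topology (A_c n) (A_norm n) closure_of (smooth_distributions \<inter> A_c n) = A_c n \<and>
      norm_topology (A_r n) (A_norm n) closure_of (smooth_distributions \<inter> A_r n) \<noteq> A_r n)"
proof (intro conjI)
  note lin = plus_distribution.rep_eq scaleR_distribution.rep_eq
  show "\<langle>a1 *\<^sub>R f1 + a2 *\<^sub>R f2, \<phi>\<rangle> = a1 * \<langle>f1, \<phi>\<rangle> + a2 * \<langle>f2, \<phi>\<rangle>"
    by (simp add: lin)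
  show "a1 * \<langle>f1, \<phi>\<rangle> + a2 * \<langle>f2, \<phi>\<rangle> =
      (- 1) ^ n * (a1 * \<langle>of_fun (F1 \<circ> ereal), (test_deriv ^^ n) \<phi>\<rangle>
                 + a2 * \<langle>of_fun (F2 \<circ> ereal), (test_deriv ^^ n) \<phi>\<rangle>)"
    unfolding f1(3) f2(3) by (simp add: dist_deriv.rep_eq algebra_simps)
  show "(- 1) ^ n * (a1 * \<langle>of_fun (F1 \<circ> ereal), (test_deriv ^^ n) \<phi>\<rangle>
                 + a2 * \<langle>of_fun (F2 \<circ> ereal), (test_deriv ^^ n) \<phi>\<rangle>) =
      (- 1) ^ n * (a1 * (LINT x|lebesgue. F1 (ereal x) * (deriv ^^ n) (apply_test \<phi>) x)
                 + a2 * (LINT x|lebesgue. F2 (ereal x) * (deriv ^^ n) (apply_test \<phi>) x))"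
    using B_r_locally_integrable[OF f1(2)] B_r_locally_integrable[OF f2(2)]
    by (simp add: pairing_of_fun apply_test_deriv_funpow)
  have fF: "f = B_deriv n F"
    using f(3) by (simp add: B_deriv_def)
  show "A_norm n f = B_norm F"
    unfolding fF by (rule A_norm_B_deriv[OF f(2)])
  have iso_r: "isometrically_isomorphic B_r B_norm (A_r n) (A_norm n)"
    unfolding A_r_eq by (rule isometrically_isomorphic_B_deriv) simp
  show "isometrically_isomorphic (A_r n) (A_norm n) B_r B_norm"
    by (rule isometrically_isomorphic_sym[OF subspace_B_r iso_r])
  have iso_c: "isometrically_isomorphic B_c B_norm (A_c n) (A_norm n)"
    unfolding A_c_eq by (rule isometrically_isomorphic_B_deriv[OF B_c_subset_B_r])
  show "isometrically_isomorphic (A_c n) (A_norm n) B_c B_norm"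
    by (rule isometrically_isomorphic_sym[OF subspace_B_c iso_c])
  show "\<forall>g\<in>A_r n. tempered g \<and> order_at_most n g"
    unfolding A_r_eq using tempered_B_deriv order_at_most_B_deriv by blast
  show "\<forall>Op :: distribution \<Rightarrow> distribution.
      (\<forall>T. dist_deriv 1 (Op T) = Op (dist_deriv 1 T)) \<longrightarrow>
      \<langle>Op f, \<phi>\<rangle> = (- 1) ^ n * \<langle>Op (of_fun (F \<circ> ereal)), (test_deriv ^^ n) \<phi>\<rangle>"
  proof (intro allI impI)
    fix Op :: "distribution \<Rightarrow> distribution"
    assume "\<forall>T. dist_deriv 1 (Op T) = Op (dist_deriv 1 T)"
    then have "Op f = dist_deriv n (Op (of_fun (F \<circ> ereal)))"
      unfolding f(3) using commuting_dist_deriv[of Op n] by metis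
    then show "\<langle>Op f, \<phi>\<rangle> = (- 1) ^ n * \<langle>Op (of_fun (F \<circ> ereal)), (test_deriv ^^ n) \<phi>\<rangle>"
      by (simp add: dist_deriv.rep_eq)
  qed
  show "\<forall>t T. (T \<in> A_r n \<longleftrightarrow> dist_translate t T \<in> A_r n) \<and>
      (T \<in> A_c n \<longleftrightarrow> dist_translate t T \<in> A_c n) \<and>
      A_norm n (dist_translate t f) = A_norm n f"
    using f(2) by (simp add: dist_translate_in_A_r_iff dist_translate_in_A_c_iff fF
        dist_translate_B_deriv A_norm_B_deriv B_r_translate B_norm_translate)
  show "\<forall>g\<in>A_c n. ((\<lambda>t. A_norm n (g - dist_translate t g)) \<longlongrightarrow> 0) (at 0)"
  proof
    fix g assume "g \<in> A_c n"
    then obtain G where G: "G \<in> B_c" "g = B_deriv n G"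
      by (auto simp: A_c_eq)
    have "A_norm n (g - dist_translate t g) = B_norm (G - (\<lambda>x. G (x - ereal t)))" for t
      unfolding G(2) dist_translate_B_deriv[OF B_c_imp_B_r[OF G(1)]]
      by (intro A_norm_diff B_r_translate B_c_imp_B_r G)
    then show "((\<lambda>t. A_norm n (g - dist_translate t g)) \<longlongrightarrow> 0) (at 0)"
      using B_c_translate_tendsto[OF G(1)] by simp
  qed
qed (rule subspace_A_r subspace_A_c A_c_subset_A_r norm_on_A_r banach_on_A_r not_separable_A_r
    banach_on_A_c separable_A_c smooth_dense_A_c smooth_not_dense_A_r)+

end
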